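(* For every $n\ge 3$ there exist $\omega\in\mathbb{R}^n$ and $\gamma\in\mathbb{R}_{>0}^n$ for which the Kuramoto model on the ring with $n$ oscillators and parameters $\omega,\gamma$ has a bifurcation which involves two branches of phase-locked solutions colliding as $\sigma$ increases. Furthermore, for every $n\ge 5$ there exist $\omega\in\mathbb{R}^n$ and $\gamma\in\mathbb{R}_{>0}^n$ for which the Kuramoto model on the ring with $n$ oscillators and parameters $\omega,\gamma$ has a bifurcation which involves a branch of stable phase-locked solutions colliding with a branch of 1-saddles as $\sigma$ increases.
   Context: Indices are taken modulo $n$. For $\theta\in\mathbb{R}^n$ the angle differences are $\eta_i=\theta_{i+1}-\theta_i$. The Kuramoto model on the ring with natural frequencies $\omega\in\mathbb{R}^n$, coupling strengths $\gamma\in\mathbb{R}_{>0}^n$ and parameter $\sigma>0$ is $$\frac{d\theta_i}{dt}=\omega_i+\sigma(\gamma_i\sin\eta_i-\gamma_{i-1}\sin\eta_{i-1}),\quad i=1,\dots,n,$$ i.e. $\frac{d\theta}{dt}=\omega-\sigma g(\theta,\gamma)$, where $g(\theta,\gamma)_i:=-\gamma_i\sin\eta_i+\gamma_{i-1}\sin\eta_{i-1}$. $J(\theta,\gamma)\in\mathbb{R}^{n\times n}$ is the Jacobian $J(\theta,\gamma)_{ij}=\partial g(\theta,\gamma)_i/\partial\theta_j$; it is symmetric and $J(\theta,\gamma)\mathbf 1=0$, where $\mathbf 1=(1,\dots,1)^\top$. Let $P$ be an $(n-1)\times n$ matrix whose rows form an orthonormal basis of $\mathbf 1^\perp$, and set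 $\det_{\mathrm{Red}}(J(\theta,\gamma)):=\det(PJ(\theta,\gamma)P^\top)$ (independent of the choice of $P$). With $\overline\omega=\frac1n\sum_i\omega_i$, a phase-locked solution at parameter $\sigma$ is a solution of the form $\theta(t)=\overline\omega\,\mathbf 1\,t+\theta$ with constant $\theta\in\mathbb{R}^n$, identified with the point $\theta$; equivalently $\sigma g(\theta,\gamma)=\omega-\overline\omega\,\mathbf 1$. It is called stable if all eigenvalues of $J(\theta,\gamma)$ are positive except for one eigenvalue $0$ with eigenvector $\mathbf 1$; it is called a 1-saddle if, apart from the eigenvalue $0$ with eigenvector $\mathbf 1$, $J(\theta,\gamma)$ has exactly one negative eigenvalue and all the others are positive. "A bifurcation which involves two branches of phase-locked solutions colliding as $\sigma$ increases" means: there are $\theta_0\in\mathbb{R}^n$, $\sigma_0>0$, $\epsilon\in(0,\sigma_0)$ and two continuous maps $\theta_1,\theta_2:(\sigma_0-\epsilon,\sigma_0]\to\mathbb{R}^n$ (the branches) such that $\theta_k(\sigma)$ is a phase-locked solution at parameter $\sigma$ for every $\sigma$ and $k=1,2$; $\theta_1(\sigma_0)=\theta_2(\sigma_0)=\theta_0$; and for all $\sigma\in(\sigma_0-\epsilon,\sigma_0)$, $\det_{\mathrm{Red}}(J(\theta_k(\sigma),\gamma))\ne0$ for $k=1,2$ and $\theta_1(\sigma)-\theta_2(\sigma)\notin\mathbb{R}\mathbf 1$. A branch consists of stable solutions (resp. 1-saddles) if $\theta_k(\sigma)$ is stable (resp. a 1-saddle) for all $\sigma<\sigma_0$ sufficiently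 close to $\sigma_0$. *)

theory Defs
  imports "HOL-Analysis.Analysis" "Jordan_Normal_Form.Char_Poly"
begin

unbundle no vec_syntax and no inner_syntax
hide_const (open) Finite_Cartesian_Product.vec Determinants.det

text \<open>
  Vectors in \<open>\<real>\<^sup>n\<close> are elements of \<^term>\<open>carrier_vec n\<close>.
  The oscillators are numbered \<open>0, \<dots>, n - 1\<close>; the neighbours of \<open>i\<close> on the ring are
  \<open>Suc i mod n\<close> and \<open>(i + n - 1) mod n\<close>.
\<close>

definition ones :: "nat \<Rightarrow> real vec" where
  "ones n = vec n (\<lambda>_. 1)"

definition angle_diff :: "nat \<Rightarrow> real vec \<Rightarrow> nat \<Rightarrow> real" where
  "angle_diff n \<theta> i = \<theta> $ (Suc i mod n) - \<theta> $ i"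

definition coupling :: "nat \<Rightarrow> real vec \<Rightarrow> real vec \<Rightarrow> real vec" where
  "coupling n \<gamma> \<theta> = vec n (\<lambda>i.
     - \<gamma> $ i * sin (angle_diff n \<theta> i)
     + \<gamma> $ ((i + n - 1) mod n) * sin (angle_diff n \<theta> ((i + n - 1) mod n)))"

definition kuramoto_solution ::
  "nat \<Rightarrow> real vec \<Rightarrow> real vec \<Rightarrow> real \<Rightarrow> (real \<Rightarrow> real vec) \<Rightarrow> bool" where
  "kuramoto_solution n \<omega> \<gamma> \<sigma> x \<longleftrightarrow>
     (\<forall>t. x t \<in> carrier_vec n \<and>
        (\<forall>i<n. ((\<lambda>s. x s $ i) has_real_derivative
                 (\<omega> - \<sigma> \<cdot>\<^sub>v coupling n \<gamma> (x t)) $ i) (at t)))"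

definition mean :: "nat \<Rightarrow> real vec \<Rightarrow> real" where
  "mean n \<omega> = (\<Sum>i<n. \<omega> $ i) / real n"

definition phase_locked :: "nat \<Rightarrow> real vec \<Rightarrow> real vec \<Rightarrow> real \<Rightarrow> real vec \<Rightarrow> bool" where
  "phase_locked n \<omega> \<gamma> \<sigma> \<theta> \<longleftrightarrow>
     \<theta> \<in> carrier_vec n \<and>
     kuramoto_solution n \<omega> \<gamma> \<sigma> (\<lambda>t. (mean n \<omega> * t) \<cdot>\<^sub>v ones n + \<theta>)"

definition jacobian :: "nat \<Rightarrow> real vec \<Rightarrow> real vec \<Rightarrow> real mat" where
  "jacobian n \<gamma> \<theta> = mat n n (\<lambda>(i, j).
     deriv (\<lambda>s. coupling n \<gamma> (\<theta> + s \<cdot>\<^sub>v unit_vec n j) $ i) 0)"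

text \<open>
  The \<open>n - 1\<close> rows of \<open>P\<close> are orthonormal and orthogonal to \<open>ones n\<close>; by dimension they
  form a basis of the orthogonal complement of \<open>ones n\<close>.
\<close>

definition complement_onb :: "nat \<Rightarrow> real mat \<Rightarrow> bool" where
  "complement_onb n P \<longleftrightarrow>
     P \<in> carrier_mat (n - 1) n \<and> P * P\<^sup>T = 1\<^sub>m (n - 1) \<and> P *\<^sub>v ones n = 0\<^sub>v (n - 1)"

text \<open>
  The choice of \<open>P\<close> is possible (lemma \<open>complement_onb_exists\<close>) and immaterial
  (lemma \<open>det_red_eq\<close>).
\<close>

definition det_red :: "nat \<Rightarrow> real mat \<Rightarrow> real" where
  "det_red n A = (let P = (SOME P. complement_onb n P) in det (P * A * P\<^sup>T))"

text \<open>
  The multiset of real eigenvalues, counted with algebraic multiplicity. For the Jacobian,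
  which is symmetric (lemma \<open>jacobian_symmetric\<close>), these are all \<open>n\<close> complex eigenvalues.
\<close>

definition eigenvalues :: "real mat \<Rightarrow> real multiset" where
  "eigenvalues A = proots (char_poly A)"

definition linearly_stable :: "nat \<Rightarrow> real vec \<Rightarrow> real vec \<Rightarrow> bool" where
  "linearly_stable n \<gamma> \<theta> \<longleftrightarrow>
     (let J = jacobian n \<gamma> \<theta> in
        eigenvector J (ones n) 0 \<and>
        (\<forall>l \<in># eigenvalues J - {#0#}. 0 < l))"

definition one_saddle :: "nat \<Rightarrow> real vec \<Rightarrow> real vec \<Rightarrow> bool" where
  "one_saddle n \<gamma> \<theta> \<longleftrightarrow>
     (let J = jacobian n \<gamma> \<theta> in
        eigenvector J (ones n) 0 \<and>
        (\<exists>\<mu> \<in># eigenvalues J - {#0#}. \<mu> < 0 \<and>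
           (\<forall>l \<in># eigenvalues J - {#0#} - {#\<mu>#}. 0 < l)))"

definition branch ::
  "nat \<Rightarrow> real vec \<Rightarrow> real vec \<Rightarrow> real \<Rightarrow> real \<Rightarrow> (real \<Rightarrow> real vec) \<Rightarrow> bool" where
  "branch n \<omega> \<gamma> \<sigma>\<^sub>0 \<epsilon> \<theta> \<longleftrightarrow>
     (\<forall>\<sigma> \<in> {\<sigma>\<^sub>0 - \<epsilon><..\<sigma>\<^sub>0}. phase_locked n \<omega> \<gamma> \<sigma> (\<theta> \<sigma>)) \<and>
     (\<forall>i<n. continuous_on {\<sigma>\<^sub>0 - \<epsilon><..\<sigma>\<^sub>0} (\<lambda>\<sigma>. \<theta> \<sigma> $ i)) \<and>
     (\<forall>\<sigma> \<in> {\<sigma>\<^sub>0 - \<epsilon><..<\<sigma>\<^sub>0}. det_red n (jacobian n \<gamma> (\<theta> \<sigma>)) \<noteq> 0)"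

definition branches_collide ::
  "nat \<Rightarrow> real vec \<Rightarrow> real vec \<Rightarrow> real vec \<Rightarrow> real \<Rightarrow> real \<Rightarrow>
    (real \<Rightarrow> real vec) \<Rightarrow> (real \<Rightarrow> real vec) \<Rightarrow> bool" where
  "branches_collide n \<omega> \<gamma> \<theta>\<^sub>0 \<sigma>\<^sub>0 \<epsilon> \<theta>\<^sub>1 \<theta>\<^sub>2 \<longleftrightarrow>
     \<theta>\<^sub>0 \<in> carrier_vec n \<and> 0 < \<sigma>\<^sub>0 \<and> 0 < \<epsilon> \<and> \<epsilon> < \<sigma>\<^sub>0 \<and>
     branch n \<omega> \<gamma> \<sigma>\<^sub>0 \<epsilon> \<theta>\<^sub>1 \<and> branch n \<omega> \<gamma> \<sigma>\<^sub>0 \<epsilon> \<theta>\<^sub>2 \<and>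
     \<theta>\<^sub>1 \<sigma>\<^sub>0 = \<theta>\<^sub>0 \<and> \<theta>\<^sub>2 \<sigma>\<^sub>0 = \<theta>\<^sub>0 \<and>
     (\<forall>\<sigma> \<in> {\<sigma>\<^sub>0 - \<epsilon><..<\<sigma>\<^sub>0}. \<not> (\<exists>c. \<theta>\<^sub>1 \<sigma> - \<theta>\<^sub>2 \<sigma> = c \<cdot>\<^sub>v ones n))"

lemma phase_locked_iff:
  assumes n: "n \<ge> 1" and w: "\<omega> \<in> carrier_vec n" and th: "\<theta> \<in> carrier_vec n"
  shows "phase_locked n \<omega> \<gamma> \<sigma> \<theta> \<longleftrightarrow>
    \<sigma> \<cdot>\<^sub>v coupling n \<gamma> \<theta> = \<omega> - mean n \<omega> \<cdot>\<^sub>v ones n"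
proof -
  have shift: "coupling n \<gamma> (c \<cdot>\<^sub>v ones n + \<theta>) = coupling n \<gamma> \<theta>" for c
    using n th by (auto simp: coupling_def angle_diff_def ones_def)
  have der: "((\<lambda>s. ((mean n \<omega> * s) \<cdot>\<^sub>v ones n + \<theta>) $ i) has_real_derivative D) (at t)
     \<longleftrightarrow> D = mean n \<omega>" if i: "i < n" for i D t
  proof -
    have eq: "(\<lambda>s. ((mean n \<omega> * s) \<cdot>\<^sub>v ones n + \<theta>) $ i) = (\<lambda>s. mean n \<omega> * s + \<theta> $ i)"
      using i th by (auto simp: ones_def)
    have "((\<lambda>s. mean n \<omega> * s + \<theta> $ i) has_real_derivative mean n \<omega>) (at t)"
      by (auto intro!: derivative_eq_intros)
    then show ?thesis unfolding eq using DERIV_unique by blast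
  qed
  have dims: "dim_vec (coupling n \<gamma> \<theta>) = n" "dim_vec \<omega> = n" "dim_vec (ones n) = n"
    using w by (auto simp: coupling_def ones_def)
  have "phase_locked n \<omega> \<gamma> \<sigma> \<theta> \<longleftrightarrow>
      (\<forall>i<n. (\<omega> - \<sigma> \<cdot>\<^sub>v coupling n \<gamma> \<theta>) $ i = mean n \<omega>)"
    unfolding phase_locked_def kuramoto_solution_def shift
    using der th by (auto simp: ones_def)
  also have "\<dots> \<longleftrightarrow> \<sigma> \<cdot>\<^sub>v coupling n \<gamma> \<theta> = \<omega> - mean n \<omega> \<cdot>\<^sub>v ones n"
    unfolding vec_eq_iff using dims by (auto simp: ones_def algebra_simps)
  finally show ?thesis .
qed

text \<open>The Helmert matrix.\<close>

lemma complement_onb_exists: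
  assumes n: "n \<ge> 1"
  shows "\<exists>P. complement_onb n P"
proof -
  define h :: "nat \<Rightarrow> nat \<Rightarrow> real" where
    "h k j = (if j \<le> k then 1 else if j = Suc k then - real (Suc k) else 0)
              / sqrt (real (Suc k) * real (Suc (Suc k)))" for k j
  have sum_h: "(\<Sum>j<m. f j * h k j) =
      ((\<Sum>j\<le>k. f j) - real (Suc k) * f (Suc k)) / sqrt (real (Suc k) * real (Suc (Suc k)))"
    if "Suc k < m" for m k f
  proof -
    have "(\<Sum>j<m. f j * h k j) = (\<Sum>j\<le>Suc k. f j * h k j)"
      by (rule sum.mono_neutral_right) (use that in \<open>auto simp: h_def\<close>)
    also have "\<dots> = (\<Sum>j\<le>k. f j * h k j) + f (Suc k) * h k (Suc k)" by simp
    also have "(\<Sum>j\<le>k. f j * h k j) = (\<Sum>j\<le>k. f j) / sqrt (real (Suc k) * real (Suc (Suc k)))"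
      unfolding sum_divide_distrib by (rule sum.cong) (auto simp: h_def)
    also have "h k (Suc k) = - real (Suc k) / sqrt (real (Suc k) * real (Suc (Suc k)))"
      by (simp add: h_def)
    finally show ?thesis by (simp add: diff_divide_distrib mult.commute del: of_nat_Suc)
  qed
  have orth: "(\<Sum>j<n. h l j * h k j) = 0" if "k < l" "l < n - 1" for k l
  proof -
    have "(\<Sum>j\<le>k. h l j) = real (Suc k) * h l (Suc k)"
      using that by (simp add: h_def)
    then show ?thesis using that sum_h[of k n "h l"] by simp
  qed
  have orth': "(\<Sum>j<n. h k j * h l j) = 0" if "k \<noteq> l" "l < n - 1" "k < n - 1" for k l
    using that orth[of k l] orth[of l k] by (cases "k < l") (auto simp: mult.commute)
  have unit: "(\<Sum>j<n. h k j * h k j) = 1" if "k < n - 1" for k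
  proof -
    let ?s = "sqrt (real (Suc k) * real (Suc (Suc k)))"
    have s: "?s * ?s = real (Suc k) * real (Suc (Suc k))" "?s > 0"
      by (auto simp flip: of_nat_mult)
    have "(\<Sum>j\<le>k. h k j) - real (Suc k) * h k (Suc k)
        = (real (Suc k) + real (Suc k) * real (Suc k)) / ?s"
    proof -
      have "(\<Sum>j\<le>k. h k j) = real (Suc k) / ?s" "h k (Suc k) = - real (Suc k) / ?s"
        by (simp_all add: h_def)
      then show ?thesis by (simp add: add_divide_distrib del: of_nat_Suc)
    qed
    also have "real (Suc k) + real (Suc k) * real (Suc k) = ?s * ?s"
      unfolding s by (simp add: algebra_simps)
    finally show ?thesis using that sum_h[of k n "h k"] s(2) by simp
  qed
  have zero: "(\<Sum>j<n. h k j) = 0" if "k < n - 1" for k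
    using that sum_h[of k n "\<lambda>_. 1"] by simp
  define P where "P = mat (n - 1) n (\<lambda>(k, j). h k j)"
  have "P * P\<^sup>T = 1\<^sub>m (n - 1)"
    by (rule eq_matI)
      (auto simp: P_def scalar_prod_def orth' unit simp flip: lessThan_atLeast0)
  moreover have "P *\<^sub>v ones n = 0\<^sub>v (n - 1)"
    by (rule eq_vecI)
      (auto simp: P_def ones_def scalar_prod_def zero simp flip: lessThan_atLeast0)
  ultimately show ?thesis
    unfolding complement_onb_def by (intro exI[of _ P]) (auto simp: P_def)
qed

lemma complement_onb_proj:
  assumes n: "n \<ge> 1" and P: "complement_onb n P"
  shows "P\<^sup>T * P = 1\<^sub>m n - (1 / real n) \<cdot>\<^sub>m mat n n (\<lambda>_. 1)"
proof -
  have Pc: "P \<in> carrier_mat (n - 1) n" and PP: "P * P\<^sup>T = 1\<^sub>m (n - 1)"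
    and P1: "P *\<^sub>v ones n = 0\<^sub>v (n - 1)"
    using P by (auto simp: complement_onb_def)
  have prod: "(\<Sum>k<n. P $$ (i, k) * P $$ (j, k)) = (if i = j then 1 else 0)"
    if "i < n - 1" "j < n - 1" for i j
    using arg_cong[OF PP, of "\<lambda>A. A $$ (i, j)"] that Pc
    by (auto simp: scalar_prod_def simp flip: lessThan_atLeast0)
  have sum0: "(\<Sum>k<n. P $$ (i, k)) = 0" if "i < n - 1" for i
    using arg_cong[OF P1, of "\<lambda>v. v $ i"] that Pc
    by (auto simp: ones_def scalar_prod_def simp flip: lessThan_atLeast0)
  define c where "c = 1 / sqrt (real n)"
  have cc: "c * c = 1 / real n" using n by (simp add: c_def)
  define Q where "Q = mat n n (\<lambda>(i, j). if i < n - 1 then P $$ (i, j) else c)"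
  have "(\<Sum>k<n. Q $$ (i, k) * Q $$ (j, k)) = (if i = j then 1 else 0)"
    if "i < n" "j < n" for i j
  proof -
    consider "i < n - 1" "j < n - 1" | "i < n - 1" "j = n - 1" | "i = n - 1" "j < n - 1"
      | "i = n - 1" "j = n - 1"
      using \<open>i < n\<close> \<open>j < n\<close> by linarith
    then show ?thesis
      by cases (use that n in \<open>auto simp: Q_def prod sum0 cc
        simp flip: sum_distrib_left sum_distrib_right\<close>)
  qed
  then have "Q * Q\<^sup>T = 1\<^sub>m n"
    by (intro eq_matI) (auto simp: Q_def scalar_prod_def simp flip: lessThan_atLeast0)
  then have Q: "Q\<^sup>T * Q = 1\<^sub>m n"
    using mat_mult_left_right_inverse[of Q n "Q\<^sup>T"] by (auto simp: Q_def)
  show ?thesis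
  proof (rule eq_matI)
    fix i j assume "i < dim_row (1\<^sub>m n - (1 / real n) \<cdot>\<^sub>m mat n n (\<lambda>_. 1::real))"
      "j < dim_col (1\<^sub>m n - (1 / real n) \<cdot>\<^sub>m mat n n (\<lambda>_. 1::real))"
    then have ij: "i < n" "j < n" by auto
    have "(\<Sum>k<n. Q $$ (k, i) * Q $$ (k, j)) = (1\<^sub>m n :: real mat) $$ (i, j)"
      using arg_cong[OF Q, of "\<lambda>A. A $$ (i, j)"] ij
      by (auto simp: Q_def scalar_prod_def simp flip: lessThan_atLeast0)
    moreover have "{..<n} = insert (n - 1) {..<n - 1}" using n by auto
    ultimately have "(\<Sum>k<n - 1. P $$ (k, i) * P $$ (k, j)) + 1 / real n
        = (1\<^sub>m n :: real mat) $$ (i, j)"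
      using ij n by (auto simp: Q_def cc)
    then show "(P\<^sup>T * P) $$ (i, j) = (1\<^sub>m n - (1 / real n) \<cdot>\<^sub>m mat n n (\<lambda>_. 1)) $$ (i, j)"
      using ij Pc by (auto simp: scalar_prod_def simp flip: lessThan_atLeast0)
  qed (use Pc in auto)
qed

lemma complement_onb_det_eq:
  assumes n: "n \<ge> 1" and P: "complement_onb n P" and Q: "complement_onb n Q"
    and A: "A \<in> carrier_mat n n"
  shows "det (Q * A * Q\<^sup>T) = det (P * A * P\<^sup>T)"
proof -
  define m where "m = n - 1"
  have Pc[simp]: "P \<in> carrier_mat m n" and Qc[simp]: "Q \<in> carrier_mat m n"
    and QQ: "Q * Q\<^sup>T = 1\<^sub>m m"
    using P Q by (simp_all add: complement_onb_def m_def)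
  have PT[simp]: "P\<^sup>T \<in> carrier_mat n m" and QT[simp]: "Q\<^sup>T \<in> carrier_mat n m"
    using Pc Qc by (simp_all del: One_nat_def)
  have eq: "P\<^sup>T * P = Q\<^sup>T * Q"
    using complement_onb_proj[OF n P] complement_onb_proj[OF n Q] by simp
  define U where "U = Q * P\<^sup>T"
  have U[simp]: "U \<in> carrier_mat m m"
    unfolding U_def by (rule mult_carrier_mat[of _ _ n]) auto
  have UTc: "U\<^sup>T \<in> carrier_mat m m"
    using U by simp
  have UP: "U * P = Q"
  proof -
    have "U * P = Q * (P\<^sup>T * P)" unfolding U_def by (rule assoc_mult_mat[OF Qc PT Pc])
    also have "\<dots> = (Q * Q\<^sup>T) * Q" unfolding eq by (rule assoc_mult_mat[OF Qc QT Qc, symmetric])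
    finally show ?thesis unfolding QQ using left_mult_one_mat[OF Qc] by simp
  qed
  have UT: "U\<^sup>T = P * Q\<^sup>T"
    unfolding U_def using transpose_mult[OF Qc PT] by simp
  have UU: "U * U\<^sup>T = 1\<^sub>m m"
  proof -
    have "U * U\<^sup>T = (U * P) * Q\<^sup>T" unfolding UT by (rule assoc_mult_mat[OF U Pc QT, symmetric])
    then show ?thesis unfolding UP QQ .
  qed
  have dU: "det U * det U = 1"
    using det_mult[OF U, of "U\<^sup>T"] det_transpose[OF U] UU by simp
  have B[simp]: "P * A * P\<^sup>T \<in> carrier_mat m m"
    and PA[simp]: "P * A \<in> carrier_mat m n"
    using A Pc PT by (meson mult_carrier_mat)+
  have QT': "Q\<^sup>T = P\<^sup>T * U\<^sup>T" using transpose_mult[OF U Pc] UP by simp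
  have "Q * A * Q\<^sup>T = (U * P) * A * (P\<^sup>T * U\<^sup>T)" unfolding UP QT'[symmetric] ..
  also have "(U * P) * A = U * (P * A)" by (rule assoc_mult_mat[OF U Pc A])
  also have "U * (P * A) * (P\<^sup>T * U\<^sup>T) = (U * (P * A) * P\<^sup>T) * U\<^sup>T"
    by (rule assoc_mult_mat[OF mult_carrier_mat[OF U PA] PT UTc, symmetric])
  also have "U * (P * A) * P\<^sup>T = U * (P * A * P\<^sup>T)" by (rule assoc_mult_mat[OF U PA PT])
  finally have "det (Q * A * Q\<^sup>T) = det U * det (P * A * P\<^sup>T) * det U"
    using det_mult[of "U * (P * A * P\<^sup>T)" m "U\<^sup>T"] det_mult[OF U B] det_transpose[OF U]
      mult_carrier_mat[OF U B] by simp
  then show ?thesis using dU by (simp add: algebra_simps)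
qed

lemma det_red_eq:
  assumes "n \<ge> 1" and "complement_onb n P" and "A \<in> carrier_mat n n"
  shows "det_red n A = det (P * A * P\<^sup>T)"
  unfolding det_red_def Let_def
  by (rule complement_onb_det_eq[OF assms(1,2) _ assms(3)], rule someI, rule assms(2))

lemma jacobian_entry:
  assumes "\<theta> \<in> carrier_vec n" and i: "i < n" and j: "j < n"
  defines "k \<equiv> (i + n - 1) mod n"
  shows "jacobian n \<gamma> \<theta> $$ (i, j) =
    \<gamma> $ i * cos (angle_diff n \<theta> i) * (of_bool (i = j) - of_bool (Suc i mod n = j)) +
    \<gamma> $ k * cos (angle_diff n \<theta> k) * (of_bool (i = j) - of_bool (k = j))"
proof -
  have kn: "k < n" and sk: "Suc k mod n = i"
    using i unfolding k_def by (auto simp: mod_Suc_eq)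
  have diff: "angle_diff n (\<theta> + s \<cdot>\<^sub>v unit_vec n j) l =
      angle_diff n \<theta> l + s * (of_bool (Suc l mod n = j) - of_bool (l = j))"
    if "l < n" for s l
    using assms(1) that j by (auto simp: angle_diff_def unit_vec_def algebra_simps)
  have fn: "coupling n \<gamma> (\<theta> + s \<cdot>\<^sub>v unit_vec n j) $ i =
      - \<gamma> $ i * sin (angle_diff n \<theta> i + s * (of_bool (Suc i mod n = j) - of_bool (i = j)))
      + \<gamma> $ k * sin (angle_diff n \<theta> k + s * (of_bool (i = j) - of_bool (k = j)))" for s
    using i diff[OF i] diff[OF kn] sk by (simp add: coupling_def k_def)
  have der: "deriv (\<lambda>s. - a * sin (x + s * u) + b * sin (y + s * v)) 0 =
      a * cos x * - u + b * cos y * v" for a b x y u v :: real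
    by (rule DERIV_imp_deriv) (auto intro!: derivative_eq_intros)
  have "jacobian n \<gamma> \<theta> $$ (i, j) =
      deriv (\<lambda>s. coupling n \<gamma> (\<theta> + s \<cdot>\<^sub>v unit_vec n j) $ i) 0"
    using i j by (simp add: jacobian_def)
  then show ?thesis
    unfolding fn der by simp
qed

lemma jacobian_symmetric:
  assumes "\<theta> \<in> carrier_vec n"
  shows "(jacobian n \<gamma> \<theta>)\<^sup>T = jacobian n \<gamma> \<theta>"
proof (rule eq_matI)
  fix i j assume "i < dim_row (jacobian n \<gamma> \<theta>)" "j < dim_col (jacobian n \<gamma> \<theta>)"
  then have ij: "i < n" "j < n" by (auto simp: jacobian_def)
  have iff: "(a + n - 1) mod n = b \<longleftrightarrow> Suc b mod n = a" if "a < n" "b < n" for a b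
    using that by (cases a) (auto simp: mod_Suc split: if_splits)
  show "(jacobian n \<gamma> \<theta>)\<^sup>T $$ (i, j) = jacobian n \<gamma> \<theta> $$ (i, j)"
    using ij jacobian_entry[OF assms ij, of \<gamma>]
      jacobian_entry[OF assms ij(2,1), of \<gamma>] iff[OF ij] iff[OF ij(2,1)]
    by (auto simp: jacobian_def of_bool_def)
qed (auto simp: jacobian_def)

end

(*
  For m = n - 1 >= 3 take coupling strength m on all edges but the last, where it is 1, and let
  omega inject one unit at one end of the last edge and remove it at the other. The states
  theta_i = i y are then phase-locked at sigma = 1 / f(y) with f(y) = m sin y + sin (m y), and f has
  a positive strict local minimum at c = pi / (m - 1). So sigma is maximal at c, and the two halves
  of the curve are branches which collide there as sigma increases. For n = 3 a similar explicit
  curve works.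

  The Jacobian is the Laplacian of the ring with edge weights gamma_i cos eta_i. On the curve these
  are m cos y, m times, and cos (m y), and f'(y) = m cos y + m cos (m y) is exactly the quantity
  whose sign decides the stability when m >= 4: there cos y > 0 > cos (m y), and Cauchy-Schwarz
  along the chain of positive edges gives definiteness on the complement of the constants if
  f' > 0. If f' < 0, a rank-one determinant identity gives a negative eigenvalue, and it is the only
  one because the form is positive on the hyperplane where the negative edge does not contribute.
  Multiplicities are controlled by the rank-one eigenvalue shift A + t u u^T for A u = mu u, which
  replaces one copy of mu in the spectrum by mu + t |u|^2.
*)

theory Submission
  imports Defs
begin

section \<open>Rank-one updates and eigenvalues\<close>

definition outer :: "real vec \<Rightarrow> real vec \<Rightarrow> real mat" where
  "outer a b = mat (dim_vec a) (dim_vec b) (\<lambda>(i, j). a $ i * b $ j)"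

definition pos_def :: "real mat \<Rightarrow> bool" where
  "pos_def A \<longleftrightarrow> (\<forall>x \<in> carrier_vec (dim_row A). x \<noteq> 0\<^sub>v (dim_row A) \<longrightarrow> 0 < x \<bullet> (A *\<^sub>v x))"

lemma outer_carrier[simp]:
  "a \<in> carrier_vec n \<Longrightarrow> b \<in> carrier_vec m \<Longrightarrow> outer a b \<in> carrier_mat n m"
  by (auto simp: outer_def)

lemma outer_mult_vec:
  assumes "a \<in> carrier_vec n" "b \<in> carrier_vec m" "x \<in> carrier_vec m"
  shows "outer a b *\<^sub>v x = (b \<bullet> x) \<cdot>\<^sub>v a"
  using assms by (intro eq_vecI)
    (auto simp: outer_def scalar_prod_def sum_distrib_left ac_simps)

lemma mult_mat_outer:
  assumes M: "M \<in> carrier_mat n n" and y: "y \<in> carrier_vec n" and b: "b \<in> carrier_vec m"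
  shows "M * outer y b = outer (M *\<^sub>v y) b"
  using assms by (intro eq_matI)
    (auto simp: outer_def scalar_prod_def sum_distrib_left sum_distrib_right ac_simps)

lemma scalar_prod_outer:
  assumes "a \<in> carrier_vec n" "b \<in> carrier_vec n" "x \<in> carrier_vec n"
  shows "x \<bullet> (outer a b *\<^sub>v x) = (a \<bullet> x) * (b \<bullet> x)"
  using assms by (simp add: outer_mult_vec comm_scalar_prod[of x n a])

text \<open>The matrix determinant lemma, by block elimination. Bordering the matrix by a column and
  a row gives one block matrix with two factorisations \<open>S * L\<close> and
  \<open>L * R\<close>; as \<open>L\<close> has determinant 1, the determinants of \<open>S\<close>
  and \<open>R\<close> agree, and they are the two sides.\<close>

lemma det_one_plus_outer:
  assumes a: "a \<in> carrier_vec n" and b: "b \<in> carrier_vec n"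
  shows "det (1\<^sub>m n + outer a b) = 1 + b \<bullet> a"
proof -
  define U V where "U = mat n 1 (\<lambda>(i, _). a $ i)" and "V = mat 1 n (\<lambda>(_, j). b $ j)"
  have c: "U \<in> carrier_mat n 1" "V \<in> carrier_mat 1 n" "- U \<in> carrier_mat n 1"
    by (simp_all add: U_def V_def)
  have UV: "U * V = outer a b"
    using a b by (intro eq_matI) (auto simp: U_def V_def outer_def scalar_prod_def)
  have VU: "V * U = mat 1 1 (\<lambda>_. b \<bullet> a)"
    using a b by (intro eq_matI) (auto simp: U_def V_def scalar_prod_def)
  have O: "outer a b \<in> carrier_mat n n" using a b by simp
  define L where "L = four_block_mat (1\<^sub>m n) (0\<^sub>m n 1) V (1\<^sub>m 1)"
  have L: "L \<in> carrier_mat (n + 1) (n + 1)" and dL: "det L = 1"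
    using c by (auto simp: L_def det_four_block_mat_upper_right_zero[of _ n _ 1])
  define R where "R = four_block_mat (1\<^sub>m n) (- U) (0\<^sub>m 1 n) (1\<^sub>m 1 + V * U)"
  define S where "S = four_block_mat (1\<^sub>m n + outer a b) (- U) (0\<^sub>m 1 n) (1\<^sub>m 1)"
  have VUc: "V * U \<in> carrier_mat 1 1" using c by auto
  have R: "R \<in> carrier_mat (n + 1) (n + 1)"
    unfolding R_def using c VUc by (intro four_block_carrier_mat) auto
  have S: "S \<in> carrier_mat (n + 1) (n + 1)"
    unfolding S_def using c O by (intro four_block_carrier_mat) auto
  have dR: "det R = 1 + b \<bullet> a"
    unfolding R_def using c VUc
    by (subst det_four_block_mat_lower_left_zero[of _ n _ 1]) (auto simp: VU det_single)
  have dS: "det S = det (1\<^sub>m n + outer a b)"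
    unfolding S_def using c O
    by (subst det_four_block_mat_lower_left_zero[of _ n _ 1]) auto
  have "L * R = four_block_mat (1\<^sub>m n * 1\<^sub>m n + 0\<^sub>m n 1 * 0\<^sub>m 1 n)
      (1\<^sub>m n * (- U) + 0\<^sub>m n 1 * (1\<^sub>m 1 + V * U))
      (V * 1\<^sub>m n + 1\<^sub>m 1 * 0\<^sub>m 1 n) (V * (- U) + 1\<^sub>m 1 * (1\<^sub>m 1 + V * U))"
    unfolding L_def R_def using c VUc by (intro mult_four_block_mat) auto
  also have "\<dots> = four_block_mat (1\<^sub>m n) (- U) V (1\<^sub>m 1)"
  proof (rule cong_four_block_mat)
    show "1\<^sub>m n * (- U) + 0\<^sub>m n 1 * (1\<^sub>m 1 + V * U) = - U"
      using c VUc by (subst left_mult_zero_mat) auto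
    have "V * (- U) = - (V * U)" using c by simp
    then show "V * (- U) + 1\<^sub>m 1 * (1\<^sub>m 1 + V * U) = 1\<^sub>m 1"
      using VUc left_mult_one_mat[of "1\<^sub>m 1 + V * U" 1 1]
      by (intro eq_matI) (auto simp del: One_nat_def simp: carrier_matD[OF c(1)] carrier_matD[OF c(2)])
  qed (use c in auto)
  finally have LR: "L * R = four_block_mat (1\<^sub>m n) (- U) V (1\<^sub>m 1)" .
  have "S * L = four_block_mat ((1\<^sub>m n + outer a b) * 1\<^sub>m n + (- U) * V)
      ((1\<^sub>m n + outer a b) * 0\<^sub>m n 1 + (- U) * 1\<^sub>m 1)
      (0\<^sub>m 1 n * 1\<^sub>m n + 1\<^sub>m 1 * V) (0\<^sub>m 1 n * 0\<^sub>m n 1 + 1\<^sub>m 1 * 1\<^sub>m 1)"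
    unfolding L_def S_def using c O by (intro mult_four_block_mat) auto
  also have "\<dots> = four_block_mat (1\<^sub>m n) (- U) V (1\<^sub>m 1)"
  proof (rule cong_four_block_mat)
    have "(- U) * V = - outer a b" using c UV by simp
    then show "(1\<^sub>m n + outer a b) * 1\<^sub>m n + (- U) * V = 1\<^sub>m n"
      using O by (intro eq_matI) auto
    show "(1\<^sub>m n + outer a b) * 0\<^sub>m n 1 + (- U) * 1\<^sub>m 1 = - U"
      using O c by (subst right_mult_zero_mat[of _ n n]) auto
  qed (use c in auto)
  finally have "S * L = L * R" using LR by simp
  then have "det S * det L = det L * det R"
    using det_mult[OF S L] det_mult[OF L R] by metis
  then show ?thesis using dL dR dS by simp
qed

text \<open>Factor \<open>M\<close> out on the left. Writing the updated column as
  \<open>M *\<^sub>v y\<close> makes this possible without inverting \<open>M\<close>.\<close>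

lemma det_plus_outer:
  assumes M: "M \<in> carrier_mat n n" and y: "y \<in> carrier_vec n" and b: "b \<in> carrier_vec n"
  shows "det (M + outer (M *\<^sub>v y) b) = det M * (1 + b \<bullet> y)"
proof -
  have O: "outer y b \<in> carrier_mat n n" using y b by simp
  have "M * (1\<^sub>m n + outer y b) = M + outer (M *\<^sub>v y) b"
    using mult_mat_outer[OF M y b] mult_add_distrib_mat[OF M one_carrier_mat O] M by simp
  then show ?thesis
    using det_mult[OF M, of "1\<^sub>m n + outer y b"] O det_one_plus_outer[OF y b] by simp
qed

text \<open>For x other than \<mu>, the eigenvector u is scaled by x - \<mu> under the matrix x - A,
  so the update is again of the form \<open>outer (M *\<^sub>v y) u\<close> with y a multiple of u.
  It multiplies the determinant by 1 - t |u|^2 / (x - \<mu>); clearing the denominator gives the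
  identity.\<close>

lemma char_poly_plus_outer:
  assumes A: "A \<in> carrier_mat n n" and u: "u \<in> carrier_vec n" and ev: "A *\<^sub>v u = \<mu> \<cdot>\<^sub>v u"
  shows "char_poly (A + t \<cdot>\<^sub>m outer u u) * [:- \<mu>, 1:] = char_poly A * [:- (\<mu> + t * (u \<bullet> u)), 1:]"
    (is "?p = ?q")
proof -
  have O: "outer u u \<in> carrier_mat n n" using u by simp
  have eq: "poly ?p x = poly ?q x" if x: "x \<noteq> \<mu>" for x
  proof -
    define M where "M = - char_matrix A x"
    define y where "y = (- t / (x - \<mu>)) \<cdot>\<^sub>v u"
    have M: "M \<in> carrier_mat n n" using A by (simp add: M_def)
    have y: "y \<in> carrier_vec n" using u by (simp add: y_def)
    have Ai: "(\<Sum>j<n. A $$ (i, j) * u $ j) = \<mu> * u $ i" if "i < n" for i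
      using arg_cong[OF ev, of "\<lambda>v. v $ i"] A u that
      by (auto simp: scalar_prod_def lessThan_atLeast0)
    have Mu: "M *\<^sub>v u = (x - \<mu>) \<cdot>\<^sub>v u"
    proof (rule eq_vecI)
      fix i assume "i < dim_vec ((x - \<mu>) \<cdot>\<^sub>v u)"
      then have i: "i < n" using u by simp
      have "(M *\<^sub>v u) $ i = (\<Sum>j<n. M $$ (i, j) * u $ j)"
        using M u i by (auto simp: scalar_prod_def lessThan_atLeast0)
      also have "\<dots> = (\<Sum>j<n. (if i = j then x * u $ j else 0) - A $$ (i, j) * u $ j)"
        using A i by (intro sum.cong) (auto simp: M_def char_matrix_def algebra_simps)
      also have "\<dots> = x * u $ i - \<mu> * u $ i"
        using i by (simp add: sum_subtractf Ai)
      finally show "(M *\<^sub>v u) $ i = ((x - \<mu>) \<cdot>\<^sub>v u) $ i"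
        using i u by (simp add: algebra_simps)
    qed (use M u in auto)
    have My: "M *\<^sub>v y = (- t) \<cdot>\<^sub>v u"
    proof -
      have "M *\<^sub>v y = (- t / (x - \<mu>)) \<cdot>\<^sub>v (M *\<^sub>v u)"
        unfolding y_def by (rule mult_mat_vec[OF M u])
      then show ?thesis using x by (simp add: Mu smult_smult_assoc)
    qed
    have "M + outer (M *\<^sub>v y) u = - char_matrix (A + t \<cdot>\<^sub>m outer u u) x"
      unfolding My unfolding M_def using A u
      by (intro eq_matI) (auto simp: char_matrix_def outer_def)
    then have "poly (char_poly (A + t \<cdot>\<^sub>m outer u u)) x = poly (char_poly A) x * (1 + u \<bullet> y)"
      using det_plus_outer[OF M y u] char_poly_matrix[OF A] O A
        char_poly_matrix[of "A + t \<cdot>\<^sub>m outer u u" n] by (simp add: M_def)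
    moreover have "u \<bullet> y = - t / (x - \<mu>) * (u \<bullet> u)"
      unfolding y_def using u by simp
    ultimately show ?thesis
      using x by (simp add: field_simps)
  qed
  \<comment> \<open>The two polynomials agree everywhere except possibly at \<mu>, hence at
    infinitely many points, hence identically.\<close>
  have "infinite (UNIV - {\<mu>})" by (simp add: infinite_UNIV_char_0)
  moreover have "UNIV - {\<mu>} \<subseteq> {x. poly (?p - ?q) x = 0}" using eq by auto
  ultimately have "infinite {x. poly (?p - ?q) x = 0}" using finite_subset by blast
  then have "?p - ?q = 0" using poly_roots_finite by blast
  then show ?thesis by simp
qed

lemma char_poly_nonzero:
  fixes A :: "real mat"
  assumes "A \<in> carrier_mat n n"
  shows "char_poly A \<noteq> 0"
  using degree_monic_char_poly[OF assms] by auto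

text \<open>Taking roots with multiplicity turns the linear factors into singletons. The exchange of
  one eigenvalue is written additively because multiset subtraction truncates.\<close>

lemma eigenvalues_plus_outer:
  assumes A: "A \<in> carrier_mat n n" and u: "u \<in> carrier_vec n" and ev: "A *\<^sub>v u = \<mu> \<cdot>\<^sub>v u"
  shows "eigenvalues (A + t \<cdot>\<^sub>m outer u u) + {#\<mu>#} = eigenvalues A + {#\<mu> + t * (u \<bullet> u)#}"
proof -
  have B: "A + t \<cdot>\<^sub>m outer u u \<in> carrier_mat n n" using A u by auto
  show ?thesis
    using arg_cong[OF char_poly_plus_outer[OF assms, of t], of proots]
    by (simp add: eigenvalues_def proots_mult char_poly_nonzero[OF A] char_poly_nonzero[OF B]
        del: mult_pCons_right)
qed

lemma in_eigenvalues_iff: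
  assumes "A \<in> carrier_mat n n"
  shows "l \<in># eigenvalues A \<longleftrightarrow> eigenvalue A l"
  using char_poly_nonzero[OF assms] eigenvalue_root_char_poly[OF assms]
  by (simp add: eigenvalues_def)

section \<open>Signs of eigenvalues and determinants\<close>

lemma scalar_prod_self_pos:
  fixes x :: "real vec"
  assumes "x \<in> carrier_vec n" "x \<noteq> 0\<^sub>v n"
  shows "0 < x \<bullet> x"
proof -
  obtain i where i: "i < n" "x $ i \<noteq> 0"
    using assms by (metis eq_vecI carrier_vecD index_zero_vec)
  have "0 < (\<Sum>i\<in>{0..<n}. x $ i * x $ i)"
    by (rule sum_pos2[of _ i]) (use i in \<open>auto simp: zero_less_mult_iff linorder_neq_iff\<close>)
  then show ?thesis using assms by (simp add: scalar_prod_def)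
qed

lemma pos_def_eigenvalue_pos:
  assumes A: "A \<in> carrier_mat n n" and "pos_def A" and "eigenvalue A l"
  shows "0 < l"
proof -
  obtain v where v: "v \<in> carrier_vec n" "v \<noteq> 0\<^sub>v n" "A *\<^sub>v v = l \<cdot>\<^sub>v v"
    using assms by (auto simp: eigenvalue_def eigenvector_def)
  have "0 < v \<bullet> (A *\<^sub>v v)" using assms v by (auto simp: pos_def_def)
  then have "0 < l * (v \<bullet> v)" using v by simp
  then show ?thesis using scalar_prod_self_pos[OF v(1,2)] by (simp add: zero_less_mult_iff)
qed

text \<open>The characteristic polynomial of \<open>- A\<close> equals \<open>det A\<close> at 0 and
  is monic, so it has a positive root by the intermediate value theorem. Working with
  \<open>- A\<close> avoids a sign that depends on the parity of n.\<close>

lemma det_neg_imp_eigenvalue_neg: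
  fixes A :: "real mat"
  assumes A: "A \<in> carrier_mat n n" and d: "det A < 0"
  obtains \<mu> where "\<mu> < 0" "eigenvalue A \<mu>"
proof -
  define p where "p = char_poly (- A)"
  have mA: "- A \<in> carrier_mat n n" using A by simp
  have "- char_matrix (- A) 0 = A"
    using A by (intro eq_matI) (auto simp: char_matrix_def)
  then have p0: "poly p 0 < 0" using d char_poly_matrix[OF mA] by (simp add: p_def)
  have "lead_coeff p > 0" using degree_monic_char_poly[OF mA] by (auto simp: p_def)
  from poly_pinfty_gt_lc[OF this] obtain N where N: "\<And>x. x \<ge> N \<Longrightarrow> poly p x \<ge> lead_coeff p"
    by blast
  have "poly p (max N 1) > 0" using N[of "max N 1"] \<open>lead_coeff p > 0\<close> by simp
  with p0 obtain x where x: "x > 0" "poly p x = 0"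
    using poly_IVT_pos[of 0 "max N 1" p] by force
  then have "eigenvalue (- A) x" using eigenvalue_root_char_poly[OF mA] by (simp add: p_def)
  then obtain v where v: "v \<in> carrier_vec n" "v \<noteq> 0\<^sub>v n" "(- A) *\<^sub>v v = x \<cdot>\<^sub>v v"
    using mA by (auto simp: eigenvalue_def eigenvector_def)
  have "A *\<^sub>v v = (- x) \<cdot>\<^sub>v v"
  proof (rule eq_vecI)
    fix i assume i: "i < dim_vec ((- x) \<cdot>\<^sub>v v)"
    then show "(A *\<^sub>v v) $ i = ((- x) \<cdot>\<^sub>v v) $ i"
      using arg_cong[OF v(3), of "\<lambda>v. v $ i"] A v(1)
      by (auto simp: scalar_prod_def sum_negf)
  qed (use A v in auto)
  then have "eigenvalue A (- x)"
    using A v by (auto simp: eigenvalue_def eigenvector_def)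
  then show thesis using that[of "- x"] x by simp
qed

text \<open>A zero determinant would give a kernel vector and a negative one a negative eigenvalue;
  both contradict positivity of the form.\<close>

lemma pos_def_det_pos:
  fixes A :: "real mat"
  assumes A: "A \<in> carrier_mat n n" and pd: "pos_def A"
  shows "0 < det A"
proof (rule ccontr)
  assume "\<not> 0 < det A"
  then consider "det A = 0" | "det A < 0" by linarith
  then show False
  proof cases
    case 1
    then obtain v where v: "v \<in> carrier_vec n" "v \<noteq> 0\<^sub>v n" "A *\<^sub>v v = 0\<^sub>v n"
      using det_0_iff_vec_prod_zero[OF A] by auto
    then show False using A pd by (auto simp: pos_def_def)
  next
    case 2
    then obtain \<mu> where "\<mu> < 0" "eigenvalue A \<mu>"
      using det_neg_imp_eigenvalue_neg[OF A] by blast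
    then show False using pos_def_eigenvalue_pos[OF A pd] by fastforce
  qed
qed

section \<open>The Jacobian as a weighted ring Laplacian\<close>

definition weight :: "nat \<Rightarrow> real vec \<Rightarrow> real vec \<Rightarrow> nat \<Rightarrow> real" where
  "weight n \<gamma> \<theta> i = \<gamma> $ i * cos (angle_diff n \<theta> i)"

lemma jacobian_carrier[simp]: "jacobian n \<gamma> \<theta> \<in> carrier_mat n n"
  by (simp add: jacobian_def)

lemma ones_carrier[simp]: "ones n \<in> carrier_vec n"
  by (simp add: ones_def)

lemma ones_scalar_prod: "x \<in> carrier_vec n \<Longrightarrow> ones n \<bullet> x = (\<Sum>i<n. x $ i)"
  by (auto simp: ones_def scalar_prod_def lessThan_atLeast0)

lemma jacobian_mult_vec:
  assumes th: "\<theta> \<in> carrier_vec n" and x: "x \<in> carrier_vec n" and i: "i < n"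
  shows "(jacobian n \<gamma> \<theta> *\<^sub>v x) $ i = weight n \<gamma> \<theta> i * (x $ i - x $ (Suc i mod n)) +
     weight n \<gamma> \<theta> ((i + n - 1) mod n) * (x $ i - x $ ((i + n - 1) mod n))"
proof -
  define k where "k = (i + n - 1) mod n"
  define l where "l = Suc i mod n"
  have kl: "k < n" "l < n" using i by (auto simp: k_def l_def)
  have "(jacobian n \<gamma> \<theta> *\<^sub>v x) $ i = (\<Sum>j<n. jacobian n \<gamma> \<theta> $$ (i, j) * x $ j)"
    using x i carrier_matD[OF jacobian_carrier[of n \<gamma> \<theta>]]
    by (auto simp: scalar_prod_def lessThan_atLeast0)
  also have "\<dots> = (\<Sum>j<n. weight n \<gamma> \<theta> i * ((if i = j then x $ j else 0) - (if l = j then x $ j else 0))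
      + weight n \<gamma> \<theta> k * ((if i = j then x $ j else 0) - (if k = j then x $ j else 0)))"
  proof (intro sum.cong refl)
    fix j assume "j \<in> {..<n}"
    then have e: "jacobian n \<gamma> \<theta> $$ (i, j) = weight n \<gamma> \<theta> i * (of_bool (i = j) - of_bool (l = j)) +
        weight n \<gamma> \<theta> k * (of_bool (i = j) - of_bool (k = j))"
      using jacobian_entry[OF th i, of j \<gamma>] by (simp only: lessThan_iff weight_def k_def l_def)
    show "jacobian n \<gamma> \<theta> $$ (i, j) * x $ j =
        weight n \<gamma> \<theta> i * ((if i = j then x $ j else 0) - (if l = j then x $ j else 0)) +
        weight n \<gamma> \<theta> k * ((if i = j then x $ j else 0) - (if k = j then x $ j else 0))"
      unfolding e of_bool_def by (cases "i = j"; cases "l = j"; cases "k = j") (simp_all add: algebra_simps)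
  qed
  also have "\<dots> = weight n \<gamma> \<theta> i * (x $ i - x $ l) + weight n \<gamma> \<theta> k * (x $ i - x $ k)"
    using i kl by (simp add: sum.distrib sum_distrib_left[symmetric] sum_subtractf)
  finally show ?thesis by (simp add: k_def l_def)
qed

lemma bij_betw_ring_succ:
  assumes "n \<ge> 1"
  shows "bij_betw (\<lambda>i. Suc i mod n) {..<n} {..<n}"
proof (rule bij_betw_byWitness[where f' = "\<lambda>i. (i + n - 1) mod n"])
  show "\<forall>a\<in>{..<n}. (Suc a mod n + n - 1) mod n = a"
    using assms by (auto simp: mod_Suc)
  show "\<forall>a\<in>{..<n}. Suc ((a + n - 1) mod n) mod n = a"
    using assms by (auto simp: mod_Suc_eq)
qed (use assms in auto)

lemma ring_pred_succ: "i < n \<Longrightarrow> (Suc i mod n + n - 1) mod n = i"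
  by (auto simp: mod_Suc)

text \<open>Summation by parts on the ring: reindexing the predecessor terms by the successor map
  collects the two contributions of each edge into a square.\<close>

lemma jacobian_quadratic_form:
  assumes n: "n \<ge> 1" and th: "\<theta> \<in> carrier_vec n" and x: "x \<in> carrier_vec n"
  shows "x \<bullet> (jacobian n \<gamma> \<theta> *\<^sub>v x) = (\<Sum>i<n. weight n \<gamma> \<theta> i * (x $ (Suc i mod n) - x $ i)\<^sup>2)"
proof -
  let ?w = "weight n \<gamma> \<theta>"
  have J: "jacobian n \<gamma> \<theta> *\<^sub>v x \<in> carrier_vec n"
    by (rule mult_mat_vec_carrier[OF jacobian_carrier x])
  have "x \<bullet> (jacobian n \<gamma> \<theta> *\<^sub>v x) = (\<Sum>i<n. x $ i * (jacobian n \<gamma> \<theta> *\<^sub>v x) $ i)"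
    using J by (simp add: scalar_prod_def lessThan_atLeast0 del: dim_mult_mat_vec)
  also have "\<dots> = (\<Sum>i<n. x $ i * (?w i * (x $ i - x $ (Suc i mod n)))) +
      (\<Sum>i<n. x $ i * (?w ((i + n - 1) mod n) * (x $ i - x $ ((i + n - 1) mod n))))"
    unfolding sum.distrib[symmetric]
    by (intro sum.cong refl) (simp add: jacobian_mult_vec[OF th x] distrib_left)
  also have "(\<Sum>i<n. x $ i * (?w ((i + n - 1) mod n) * (x $ i - x $ ((i + n - 1) mod n)))) =
      (\<Sum>i<n. x $ (Suc i mod n) * (?w i * (x $ (Suc i mod n) - x $ i)))"
    by (subst sum.reindex_bij_betw[OF bij_betw_ring_succ[OF n], symmetric])
      (intro sum.cong refl, simp add: ring_pred_succ del: One_nat_def)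
  finally show ?thesis
    unfolding sum.distrib[symmetric] by (simp add: power2_eq_square algebra_simps)
qed

lemma jacobian_mult_ones:
  assumes "\<theta> \<in> carrier_vec n"
  shows "jacobian n \<gamma> \<theta> *\<^sub>v ones n = 0 \<cdot>\<^sub>v ones n"
proof (rule eq_vecI)
  fix i assume "i < dim_vec (0 \<cdot>\<^sub>v ones n)"
  then have i: "i < n" by (simp add: ones_def)
  then have "Suc i mod n < n" "(i + n - 1) mod n < n" by auto
  then show "(jacobian n \<gamma> \<theta> *\<^sub>v ones n) $ i = (0 \<cdot>\<^sub>v ones n) $ i"
    using i by (subst jacobian_mult_vec[OF assms ones_carrier i]) (simp add: ones_def)
qed (simp add: ones_def carrier_matD[OF jacobian_carrier])

lemma scalar_prod_jacobian_swap:
  assumes th: "\<theta> \<in> carrier_vec n" and "x \<in> carrier_vec n" and "y \<in> carrier_vec n"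
  shows "x \<bullet> (jacobian n \<gamma> \<theta> *\<^sub>v y) = y \<bullet> (jacobian n \<gamma> \<theta> *\<^sub>v x)"
  using transpose_vec_mult_scalar[OF jacobian_carrier assms(3,2), of \<gamma> \<theta>]
    comm_scalar_prod[OF assms(3) mult_mat_vec_carrier[OF jacobian_carrier assms(2)], of \<gamma> \<theta>]
  unfolding jacobian_symmetric[OF th] by simp

text \<open>A kernel vector carries the same flux through every edge. Its increments are therefore
  that flux divided by the weights, and they add up to 0 around the ring. A nonzero sum of
  reciprocals forces the flux to vanish, so the vector is constant, and orthogonality to
  \<open>ones n\<close> makes it 0.\<close>

lemma jacobian_kernel:
  assumes n: "n \<ge> 1" and th: "\<theta> \<in> carrier_vec n"
    and w: "\<And>i. i < n \<Longrightarrow> weight n \<gamma> \<theta> i \<noteq> 0"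
    and s: "(\<Sum>i<n. 1 / weight n \<gamma> \<theta> i) \<noteq> 0"
    and y: "y \<in> carrier_vec n" and ker: "jacobian n \<gamma> \<theta> *\<^sub>v y = 0\<^sub>v n"
    and orth: "ones n \<bullet> y = 0"
  shows "y = 0\<^sub>v n"
proof -
  let ?w = "weight n \<gamma> \<theta>"
  define d where "d i = ?w i * (y $ (Suc i mod n) - y $ i)" for i
  have pred: "d ((i + n - 1) mod n) = d i" if i: "i < n" for i
  proof -
    have "Suc ((i + n - 1) mod n) mod n = i"
      using i by (auto simp: mod_Suc_eq)
    then show ?thesis
      using i jacobian_mult_vec[OF th y i, of \<gamma>] ker by (simp add: d_def algebra_simps)
  qed
  have d0: "d i = d 0" if "i < n" for i
    using that
  proof (induction i)
    case (Suc i)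
    then show ?case using pred[of "Suc i"] by simp
  qed simp
  have diff: "y $ (Suc i mod n) - y $ i = d 0 * (1 / ?w i)" if "i < n" for i
    using d0[OF that] w[OF that] by (simp add: d_def field_simps)
  have "(\<Sum>i<n. y $ (Suc i mod n) - y $ i) = 0"
    by (simp add: sum_subtractf sum.reindex_bij_betw[OF bij_betw_ring_succ[OF n]])
  moreover have "(\<Sum>i<n. y $ (Suc i mod n) - y $ i) = d 0 * (\<Sum>i<n. 1 / ?w i)"
    unfolding sum_distrib_left by (rule sum.cong) (simp_all add: diff)
  ultimately have "d 0 = 0" using s by simp
  have const: "y $ i = y $ 0" if "i < n" for i
    using that
  proof (induction i)
    case (Suc i)
    then show ?case using diff[of i] \<open>d 0 = 0\<close> by simp
  qed simp
  have "ones n \<bullet> y = real n * y $ 0"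
  proof -
    have "(\<Sum>i<n. y $ i) = (\<Sum>i<n. y $ 0)" by (rule sum.cong[OF refl], rule const) simp
    then show ?thesis by (simp add: ones_scalar_prod[OF y])
  qed
  then have "y $ 0 = 0" using orth n by simp
  show ?thesis
  proof (rule eq_vecI)
    fix i assume "i < dim_vec (0\<^sub>v n)"
    then show "y $ i = 0\<^sub>v n $ i" using const[of i] \<open>y $ 0 = 0\<close> by simp
  qed (use y in simp)
qed

text \<open>A null vector x of the reduced matrix lifts to y = P^T x, which is orthogonal to
  \<open>ones n\<close>. It then suffices that y lies in the kernel of the full Jacobian.\<close>

lemma det_red_jacobian_nonzero:
  assumes n: "n \<ge> 1" and th: "\<theta> \<in> carrier_vec n"
    and w: "\<And>i. i < n \<Longrightarrow> weight n \<gamma> \<theta> i \<noteq> 0"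
    and s: "(\<Sum>i<n. 1 / weight n \<gamma> \<theta> i) \<noteq> 0"
  shows "det_red n (jacobian n \<gamma> \<theta>) \<noteq> 0"
proof
  let ?J = "jacobian n \<gamma> \<theta>"
  obtain P where P: "complement_onb n P" using complement_onb_exists[OF n] by blast
  define k where "k = n - 1"
  have Pc: "P \<in> carrier_mat k n" "P\<^sup>T \<in> carrier_mat n k"
    and PP: "P * P\<^sup>T = 1\<^sub>m k" and P1: "P *\<^sub>v ones n = 0\<^sub>v k"
    using P by (simp_all add: complement_onb_def k_def)
  assume "det_red n ?J = 0"
  then have "det (P * ?J * P\<^sup>T) = 0"
    using det_red_eq[OF n P jacobian_carrier] by simp
  moreover have c: "P * ?J \<in> carrier_mat k n" "P * ?J * P\<^sup>T \<in> carrier_mat k k"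
    using Pc jacobian_carrier by (meson mult_carrier_mat)+
  ultimately obtain x where x: "x \<in> carrier_vec k" "x \<noteq> 0\<^sub>v k" "(P * ?J * P\<^sup>T) *\<^sub>v x = 0\<^sub>v k"
    using det_0_iff_vec_prod_zero[of "P * ?J * P\<^sup>T" k] by auto
  define y where "y = P\<^sup>T *\<^sub>v x"
  have y: "y \<in> carrier_vec n" unfolding y_def using Pc x by simp
  have Jy: "?J *\<^sub>v y \<in> carrier_vec n" by (rule mult_mat_vec_carrier[OF jacobian_carrier y])
  have Py: "P *\<^sub>v y = x"
    unfolding y_def using assoc_mult_mat_vec[OF Pc x(1)] PP x(1) by simp
  have PJy: "P *\<^sub>v (?J *\<^sub>v y) = 0\<^sub>v k"
    using x(3) assoc_mult_mat_vec[OF c(1) Pc(2) x(1)] assoc_mult_mat_vec[OF Pc(1) jacobian_carrier y]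
    by (simp add: y_def)
  have oy: "ones n \<bullet> y = 0"
    using transpose_vec_mult_scalar[OF Pc(1) ones_carrier x(1)] P1 x(1)
      comm_scalar_prod[OF y ones_carrier] unfolding y_def by simp
  \<comment> \<open>By symmetry the image of y is orthogonal to \<open>ones n\<close>, and on that
    complement \<open>P\<^sup>T * P\<close> is the identity; so being killed by \<open>P\<close>
    means being 0.\<close>
  have "?J *\<^sub>v y = 0\<^sub>v n"
  proof -
    have "ones n \<bullet> (?J *\<^sub>v y) = 0"
      using scalar_prod_jacobian_swap[OF th ones_carrier y] jacobian_mult_ones[OF th] y by simp
    then have s0: "(\<Sum>i<n. (?J *\<^sub>v y) $ i) = 0" using ones_scalar_prod[OF Jy] by simp
    have "0\<^sub>v n = P\<^sup>T *\<^sub>v (P *\<^sub>v (?J *\<^sub>v y))" using Pc by (intro eq_vecI) (auto simp: PJy)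
    also have "\<dots> = (P\<^sup>T * P) *\<^sub>v (?J *\<^sub>v y)" using assoc_mult_mat_vec[OF Pc(2,1) Jy] by simp
    also have "\<dots> = ?J *\<^sub>v y"
    proof (rule eq_vecI)
      fix i assume "i < dim_vec (?J *\<^sub>v y)"
      then have i: "i < n" by (simp add: carrier_matD[OF jacobian_carrier])
      define z where "z = ?J *\<^sub>v y"
      have z: "z \<in> carrier_vec n" using Jy by (simp add: z_def)
      have "((P\<^sup>T * P) *\<^sub>v z) $ i = (\<Sum>j<n. (if i = j then z $ j else 0) - 1 / real n * z $ j)"
        unfolding complement_onb_proj[OF n P]
        using i z by (auto simp: scalar_prod_def lessThan_atLeast0 algebra_simps intro!: sum.cong)
      also have "\<dots> = z $ i - 1 / real n * (\<Sum>j<n. z $ j)"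
        using i by (simp add: sum_subtractf sum_distrib_left)
      finally show "((P\<^sup>T * P) *\<^sub>v (?J *\<^sub>v y)) $ i = (?J *\<^sub>v y) $ i"
        using s0 by (simp add: z_def)
    qed (use Pc in \<open>simp add: carrier_matD[OF jacobian_carrier]\<close>)
    finally show ?thesis by simp
  qed
  then have "y = 0\<^sub>v n" by (intro jacobian_kernel[OF n th w s y _ oy])
  then have "x = 0\<^sub>v k" unfolding Py[symmetric] using Pc by (intro eq_vecI) auto
  then show False using x by simp
qed

section \<open>Stability with one exceptional edge\<close>

text \<open>By Cauchy-Schwarz the squared end-to-end difference is at most m times the sum of
  squared steps, which bounds the loss when b is negative. If all steps vanish, the sequence is a
  nonzero constant and the last square is positive. The alternative \<open>x m = x 0\<close>
  describes the hyperplane on which the b-term disappears.\<close>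

lemma chain_form_pos:
  fixes x :: "nat \<Rightarrow> real"
  assumes a: "0 < a" and ab: "0 < a + real m * b \<or> x m = x 0" and nz: "\<exists>i\<le>m. x i \<noteq> 0"
  shows "0 < a * (\<Sum>i<m. (x (Suc i) - x i)\<^sup>2) + b * (x m - x 0)\<^sup>2 + (\<Sum>i\<le>m. x i)\<^sup>2"
proof -
  define D where "D = (\<Sum>i<m. (x (Suc i) - x i)\<^sup>2)"
  have D0: "0 \<le> D" unfolding D_def by (intro sum_nonneg) simp
  have cs: "(x m - x 0)\<^sup>2 \<le> real m * D"
    using sum_squared_le_sum_of_squares[of "\<lambda>i. x (Suc i) - x i" "{..<m}"]
    by (simp add: sum_lessThan_telescope D_def mult.commute)
  show ?thesis
  proof (cases "D = 0")
    case True
    then have step: "x (Suc i) = x i" if "i < m" for i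
      using that unfolding D_def by (simp add: sum_nonneg_eq_0_iff)
    have const: "x i = x 0" if "i \<le> m" for i
      using that by (induction i) (simp_all add: step)
    have "(\<Sum>i\<le>m. x i) = (\<Sum>i\<le>m. x 0)" by (rule sum.cong[OF refl], rule const) simp
    then have S: "(\<Sum>i\<le>m. x i) = (1 + real m) * x 0" by simp
    have "x 0 \<noteq> 0" using nz const by metis
    then have "(\<Sum>i\<le>m. x i)\<^sup>2 > 0" unfolding S by simp
    then show ?thesis using True const[of m] by (simp add: D_def)
  next
    case False
    with D0 have D: "0 < D" by simp
    have "0 < a * D + b * (x m - x 0)\<^sup>2"
    proof (cases "0 \<le> b \<or> x m = x 0")
      case True
      then show ?thesis using a D by (auto intro: add_pos_nonneg)
    next
      case False
      then have "b * (real m * D) \<le> b * (x m - x 0)\<^sup>2"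
        using cs by (intro mult_left_mono_neg) auto
      moreover have "0 < (a + real m * b) * D" using ab False D by simp
      ultimately show ?thesis by (simp add: algebra_simps)
    qed
    then show ?thesis unfolding D_def[symmetric] by (rule add_pos_nonneg) simp
  qed
qed

text \<open>The added rank-one term moves the eigenvalue 0 of \<open>ones n\<close> to n, so
  definiteness on the complement of the constants becomes definiteness on the whole space.\<close>

definition bordered :: "nat \<Rightarrow> real vec \<Rightarrow> real vec \<Rightarrow> real mat" where
  "bordered n \<gamma> \<theta> = jacobian n \<gamma> \<theta> + 1 \<cdot>\<^sub>m outer (ones n) (ones n)"

lemma bordered_carrier[simp]: "bordered n \<gamma> \<theta> \<in> carrier_mat n n"
  by (simp add: bordered_def)

lemma bordered_mult_vec:
  assumes "x \<in> carrier_vec n"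
  shows "bordered n \<gamma> \<theta> *\<^sub>v x = jacobian n \<gamma> \<theta> *\<^sub>v x + (ones n \<bullet> x) \<cdot>\<^sub>v ones n"
proof -
  have "1 \<cdot>\<^sub>m outer (ones n) (ones n) = outer (ones n) (ones n)"
    by (intro eq_matI) auto
  then show ?thesis
    using assms add_mult_distrib_mat_vec[OF jacobian_carrier, of "outer (ones n) (ones n)" n x \<gamma> \<theta>]
    by (simp add: bordered_def outer_mult_vec[of _ n _ n])
qed

lemma scalar_prod_bordered_swap:
  assumes th: "\<theta> \<in> carrier_vec n" and x: "x \<in> carrier_vec n" and y: "y \<in> carrier_vec n"
  shows "x \<bullet> (bordered n \<gamma> \<theta> *\<^sub>v y) = y \<bullet> (bordered n \<gamma> \<theta> *\<^sub>v x)"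
proof -
  have c: "jacobian n \<gamma> \<theta> *\<^sub>v z \<in> carrier_vec n" if "z \<in> carrier_vec n" for z
    by (rule mult_mat_vec_carrier[OF jacobian_carrier that])
  show ?thesis
    using scalar_prod_jacobian_swap[OF assms, of \<gamma>] x y
      comm_scalar_prod[OF x ones_carrier] comm_scalar_prod[OF y ones_carrier]
    by (simp add: bordered_mult_vec scalar_prod_add_distrib[of _ n] c)
qed

text \<open>A chain of n - 1 equal edges closed by one edge whose weight may have either sign. In
  series the chain acts like a single edge of weight a / (n - 1), so the sign of a + (n - 1) b is
  that of the total effective weight between the two ends.\<close>

locale one_odd_edge =
  fixes n :: nat and \<gamma> \<theta> :: "real vec" and a b :: real
  assumes n: "2 \<le> n" and th: "\<theta> \<in> carrier_vec n"
    and w: "\<And>i. i < n - 1 \<Longrightarrow> weight n \<gamma> \<theta> i = a"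
    and w_last: "weight n \<gamma> \<theta> (n - 1) = b"
    and a: "0 < a"
begin

lemma bordered_quadratic_form:
  assumes x: "x \<in> carrier_vec n"
  shows "x \<bullet> (bordered n \<gamma> \<theta> *\<^sub>v x) = a * (\<Sum>i<n - 1. (x $ Suc i - x $ i)\<^sup>2)
      + b * (x $ (n - 1) - x $ 0)\<^sup>2 + (\<Sum>i\<le>n - 1. x $ i)\<^sup>2"
proof -
  define m where "m = n - 1"
  have nm: "n = Suc m" using n by (simp add: m_def)
  have J: "jacobian n \<gamma> \<theta> *\<^sub>v x \<in> carrier_vec n"
    by (rule mult_mat_vec_carrier[OF jacobian_carrier x])
  have "x \<bullet> (bordered n \<gamma> \<theta> *\<^sub>v x) = x \<bullet> (jacobian n \<gamma> \<theta> *\<^sub>v x) + (\<Sum>i<n. x $ i)\<^sup>2"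
    using x J comm_scalar_prod[OF x ones_carrier]
    by (simp add: bordered_mult_vec scalar_prod_add_distrib[of _ n] ones_scalar_prod power2_eq_square)
  also have "x \<bullet> (jacobian n \<gamma> \<theta> *\<^sub>v x) =
      (\<Sum>i<m. weight n \<gamma> \<theta> i * (x $ (Suc i mod n) - x $ i)\<^sup>2) + b * (x $ 0 - x $ m)\<^sup>2"
    using n th x w_last by (subst jacobian_quadratic_form) (simp_all add: nm)
  also have "(\<Sum>i<m. weight n \<gamma> \<theta> i * (x $ (Suc i mod n) - x $ i)\<^sup>2) =
      a * (\<Sum>i<m. (x $ Suc i - x $ i)\<^sup>2)"
    unfolding sum_distrib_left by (rule sum.cong) (use w in \<open>auto simp: nm\<close>)
  also have "{..<n} = {..m}" by (auto simp: nm)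
  finally show ?thesis
    unfolding m_def[symmetric] by (simp add: power2_commute[of "x $ 0"])
qed

lemma nonzero_entry:
  assumes "x \<in> carrier_vec n" "x \<noteq> 0\<^sub>v n"
  shows "\<exists>i\<le>n - 1. x $ i \<noteq> 0"
proof (rule ccontr)
  assume "\<not> ?thesis"
  then have "x = 0\<^sub>v n" using assms(1) n by (intro eq_vecI) auto
  then show False using assms by simp
qed

lemma bordered_form_pos:
  assumes "x \<in> carrier_vec n" "x \<noteq> 0\<^sub>v n" "0 < a + real (n - 1) * b \<or> x $ (n - 1) = x $ 0"
  shows "0 < x \<bullet> (bordered n \<gamma> \<theta> *\<^sub>v x)"
  unfolding bordered_quadratic_form[OF assms(1)]
  by (rule chain_form_pos[OF a assms(3) nonzero_entry[OF assms(1,2)]])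

lemma eigenvalues_bordered:
  "eigenvalues (bordered n \<gamma> \<theta>) + {#0#} = eigenvalues (jacobian n \<gamma> \<theta>) + {#real n#}"
proof -
  have "ones n \<bullet> ones n = real n"
    by (simp add: ones_scalar_prod) (simp add: ones_def)
  then show ?thesis
    using eigenvalues_plus_outer[OF jacobian_carrier ones_carrier jacobian_mult_ones[OF th], of \<gamma> 1]
    by (simp add: bordered_def)
qed

lemma eigenvector_ones: "eigenvector (jacobian n \<gamma> \<theta>) (ones n) 0"
proof -
  have "ones n $ 0 \<noteq> 0\<^sub>v n $ 0" using n by (simp add: ones_def)
  then have "ones n \<noteq> 0\<^sub>v n" by metis
  then show ?thesis
    using jacobian_mult_ones[OF th]
    by (simp add: eigenvector_def carrier_matD[OF jacobian_carrier])
qed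

text \<open>This transfers statements about the spectrum of the bordered matrix to the nontrivial
  eigenvalues of the Jacobian, multiplicities included.\<close>

lemma eigenvalues_jacobian_minus:
  "eigenvalues (jacobian n \<gamma> \<theta>) - {#0#} \<subseteq># eigenvalues (bordered n \<gamma> \<theta>)"
proof -
  have "eigenvalues (bordered n \<gamma> \<theta>) = eigenvalues (jacobian n \<gamma> \<theta>) + {#real n#} - {#0#}"
    using eigenvalues_bordered by (metis add_diff_cancel_right')
  then show ?thesis
    by (simp add: subseteq_mset_def)
qed

lemma linearly_stable:
  assumes "0 < a + real (n - 1) * b"
  shows "linearly_stable n \<gamma> \<theta>"
proof -
  have "pos_def (bordered n \<gamma> \<theta>)"
    using bordered_form_pos assms by (simp add: pos_def_def carrier_matD[OF bordered_carrier])
  then have "0 < l" if "l \<in># eigenvalues (jacobian n \<gamma> \<theta>) - {#0#}" for l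
    using pos_def_eigenvalue_pos[OF bordered_carrier] in_eigenvalues_iff[OF bordered_carrier]
      mset_subset_eqD[OF eigenvalues_jacobian_minus that] by blast
  then show ?thesis
    unfolding linearly_stable_def Let_def using eigenvector_ones by blast
qed

text \<open>The bordered Jacobian with the weight of the last edge removed is positive definite, and
  the last edge is a rank-one update of it.\<close>

lemma det_bordered_neg:
  assumes neg: "a + real (n - 1) * b < 0"
  shows "det (bordered n \<gamma> \<theta>) < 0"
proof -
  define m where "m = n - 1"
  have nm: "n = Suc m" and m: "0 < m" using n by (auto simp: m_def)
  let ?A = "bordered n \<gamma> \<theta>"
  \<comment> \<open>The incidence vector of the closing edge; subtracting b times its outer square
    deletes that edge.\<close>
  define v where "v = vec n (\<lambda>i. if i = 0 then 1 else if i = m then - 1 else 0 :: real)"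
  have v: "v \<in> carrier_vec n" by (simp add: v_def)
  have vx: "v \<bullet> x = x $ 0 - x $ m" if "x \<in> carrier_vec n" for x :: "real vec"
  proof -
    have "v \<bullet> x = (\<Sum>i<n. (if i = 0 then x $ i else 0) - (if i = m then x $ i else 0))"
      using that m by (auto simp: v_def scalar_prod_def lessThan_atLeast0 intro!: sum.cong)
    then show ?thesis by (simp add: sum_subtractf nm)
  qed
  define M where "M = ?A + (- b) \<cdot>\<^sub>m outer v v"
  have O: "outer v v \<in> carrier_mat n n" using v by simp
  have M: "M \<in> carrier_mat n n" using O by (simp add: M_def)
  have Mx: "M *\<^sub>v x = ?A *\<^sub>v x + (- b * (v \<bullet> x)) \<cdot>\<^sub>v v" if x: "x \<in> carrier_vec n" for x
  proof -
    have "(- b) \<cdot>\<^sub>m outer v v = outer ((- b) \<cdot>\<^sub>v v) v"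
      using v by (intro eq_matI) (auto simp: outer_def)
    then show ?thesis
      using add_mult_distrib_mat_vec[OF bordered_carrier, of "outer ((- b) \<cdot>\<^sub>v v) v" n x \<gamma> \<theta>] v x
      by (simp add: M_def outer_mult_vec[of _ n _ n] smult_smult_assoc mult.commute)
  qed
  have "pos_def M"
    unfolding pos_def_def
  proof (intro ballI impI)
    fix x :: "real vec" assume "x \<in> carrier_vec (dim_row M)" "x \<noteq> 0\<^sub>v (dim_row M)"
    then have x: "x \<in> carrier_vec n" "x \<noteq> 0\<^sub>v n" using M by auto
    have "x \<bullet> (M *\<^sub>v x) = x \<bullet> (?A *\<^sub>v x) - b * (x $ m - x $ 0)\<^sup>2"
    proof -
      have xv: "x \<bullet> v = x $ 0 - x $ m" using vx[OF x(1)] comm_scalar_prod[OF x(1) v] by simp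
      have "x \<bullet> (M *\<^sub>v x) = x \<bullet> (?A *\<^sub>v x) + - b * (v \<bullet> x) * (x \<bullet> v)"
        using x v mult_mat_vec_carrier[OF bordered_carrier x(1), of \<gamma> \<theta>]
        by (simp add: Mx scalar_prod_add_distrib[of _ n])
      then show ?thesis
        unfolding xv vx[OF x(1)] by (simp add: power2_eq_square algebra_simps)
    qed
    also have "\<dots> = a * (\<Sum>i<m. (x $ Suc i - x $ i)\<^sup>2) + 0 * (x $ m - x $ 0)\<^sup>2 + (\<Sum>i\<le>m. x $ i)\<^sup>2"
      by (simp add: bordered_quadratic_form[OF x(1)] m_def)
    also have "\<dots> > 0"
      using chain_form_pos[OF a, of m 0 "($) x"] a nonzero_entry[OF x] by (simp add: m_def)
    finally show "0 < x \<bullet> (M *\<^sub>v x)" .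
  qed
  then have dM: "0 < det M" using pos_def_det_pos[OF M] by blast
  \<comment> \<open>The potential of a unit current along the chain: it drops by 1 / a per edge, so
    \<open>M *\<^sub>v y = v\<close>. Centring it at m / 2 makes the entries sum to 0, so that the
    border does not contribute.\<close>
  define y where "y = vec n (\<lambda>i. (real m / 2 - real i) / a)"
  have y: "y \<in> carrier_vec n" by (simp add: y_def)
  have vy: "v \<bullet> y = real m / a"
    unfolding vx[OF y] using a m by (simp add: y_def nm field_simps)
  have "(\<Sum>i<n. y $ i) = (\<Sum>i\<le>m. real m / 2 - real i) / a"
    by (simp add: y_def nm sum_divide_distrib lessThan_Suc_atMost)
  also have "(\<Sum>i\<le>m. real m / 2 - real i) = 0"
  proof -
    have "(\<Sum>i\<le>k. c - real i) = (real k + 1) * (c - real k / 2)" for c k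
      by (induction k) (simp_all add: field_simps)
    then show ?thesis by simp
  qed
  finally have oy: "ones n \<bullet> y = 0" by (simp add: ones_scalar_prod[OF y])
  have Jy: "(jacobian n \<gamma> \<theta> *\<^sub>v y) $ i = (1 + b * real m / a) * v $ i" if i: "i < n" for i
  proof -
    have wm: "weight (Suc m) \<gamma> \<theta> m = b" and wi: "\<And>i. i < m \<Longrightarrow> weight (Suc m) \<gamma> \<theta> i = a"
      using w w_last unfolding nm by simp_all
    have yi: "\<And>i. i \<le> m \<Longrightarrow> y $ i = (real m / 2 - real i) / a" by (simp add: y_def nm)
    consider "i = 0" | "i = m" | k where "i = Suc k" "i < m"
      using i nm by (cases i) force+
    then show ?thesis
    proof cases
      case 1
      then show ?thesis
        using m a by (subst jacobian_mult_vec[OF th y i]) (simp add: nm wm wi yi v_def field_simps)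
    next
      case 2
      then have "(i + n - 1) mod n = m - 1" using m by (simp add: nm mod_if)
      then show ?thesis
        using 2 m a by (subst jacobian_mult_vec[OF th y i]) (simp add: nm wm wi yi v_def field_simps)
    next
      case 3
      then have "i + n - 1 = k + n" "Suc i mod n = Suc i" by (simp_all add: nm)
      moreover from this have "(i + n - 1) mod n = k"
        using i 3 by (simp only: mod_add_self2) simp
      ultimately have "(i + n - 1) mod n = k" "Suc i mod n = Suc i" by blast+
      then show ?thesis
        using 3 m a by (subst jacobian_mult_vec[OF th y i]) (simp add: nm wm wi yi v_def field_simps)
    qed
  qed
  have My: "M *\<^sub>v y = v"
  proof (rule eq_vecI)
    fix i assume "i < dim_vec v"
    then have i: "i < n" using v by simp
    have "(M *\<^sub>v y) $ i = (jacobian n \<gamma> \<theta> *\<^sub>v y) $ i - b * (v \<bullet> y) * v $ i"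
      using i v carrier_matD[OF jacobian_carrier[of n \<gamma> \<theta>]] carrier_vecD[OF ones_carrier[of n]]
      by (simp add: Mx[OF y] bordered_mult_vec[OF y] oy del: index_mult_mat_vec)
        (simp add: ones_def)
    then show "(M *\<^sub>v y) $ i = v $ i"
      unfolding Jy[OF i] vy by (simp add: algebra_simps)
  qed (use M v in auto)
  have bv: "M *\<^sub>v (b \<cdot>\<^sub>v y) = b \<cdot>\<^sub>v v"
    using mult_mat_vec[OF M y, of b] My by simp
  \<comment> \<open>Restoring the closing edge updates \<open>M\<close> by the column b v, the image
    of b y. The determinant is thus multiplied by 1 + b m / a.\<close>
  have "?A = M + outer (M *\<^sub>v (b \<cdot>\<^sub>v y)) v"
    unfolding bv unfolding M_def using v carrier_matD[OF bordered_carrier[of n \<gamma> \<theta>]]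
    by (intro eq_matI) (auto simp: outer_def)
  then have "det ?A = det M * (1 + v \<bullet> (b \<cdot>\<^sub>v y))"
    using det_plus_outer[OF M _ v, of "b \<cdot>\<^sub>v y"] y by simp
  also have "\<dots> = det M * ((a + real m * b) / a)"
    using a v y by (simp add: vy field_simps)
  also have "\<dots> < 0"
    by (rule mult_pos_neg[OF dM divide_neg_pos[OF neg[folded m_def] a]])
  finally show ?thesis .
qed

text \<open>The negative determinant provides an eigenvalue \<mu> < 0 with eigenvector u. Moving
  \<mu> to 1 by a rank-one shift along u produces a positive definite matrix, so every other
  eigenvalue, counted with multiplicity, is positive.\<close>

lemma one_saddle:
  assumes neg: "a + real (n - 1) * b < 0"
  shows "one_saddle n \<gamma> \<theta>"
proof -
  let ?A = "bordered n \<gamma> \<theta>"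
  have c: "?A *\<^sub>v x \<in> carrier_vec n" if "x \<in> carrier_vec n" for x :: "real vec"
    by (rule mult_mat_vec_carrier[OF bordered_carrier that])
  obtain \<mu> where mu: "\<mu> < 0" "eigenvalue ?A \<mu>"
    using det_neg_imp_eigenvalue_neg[OF bordered_carrier det_bordered_neg[OF neg]] by blast
  then obtain u where u: "u \<in> carrier_vec n" "u \<noteq> 0\<^sub>v n" "?A *\<^sub>v u = \<mu> \<cdot>\<^sub>v u"
    by (auto simp: eigenvalue_def eigenvector_def carrier_matD[OF bordered_carrier])
  have uu: "0 < u \<bullet> u" by (rule scalar_prod_self_pos[OF u(1,2)])
  have uAu: "u \<bullet> (?A *\<^sub>v u) = \<mu> * (u \<bullet> u)" using u by simp
  \<comment> \<open>The bordered form is positive on the kernel of g, where the closing edge has no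
    effect.\<close>
  define g where "g x = x $ (n - 1) - x $ 0" for x :: "real vec"
  have gu: "g u \<noteq> 0"
  proof
    assume "g u = 0"
    then have "0 < u \<bullet> (?A *\<^sub>v u)" using bordered_form_pos[OF u(1,2)] by (simp add: g_def)
    then show False using uAu uu mu by (simp add: zero_less_mult_iff)
  qed
  have expand: "(\<alpha> \<cdot>\<^sub>v u + y) \<bullet> (?A *\<^sub>v (\<alpha> \<cdot>\<^sub>v u + y)) = \<alpha>\<^sup>2 * \<mu> * (u \<bullet> u) + y \<bullet> (?A *\<^sub>v y)"
    if y: "y \<in> carrier_vec n" "u \<bullet> y = 0" for \<alpha> y
  proof -
    have 1: "u \<bullet> (?A *\<^sub>v y) = 0"
      using scalar_prod_bordered_swap[OF th u(1) y(1), of \<gamma>] u y comm_scalar_prod[OF u(1) y(1)] by simp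
    have 2: "y \<bullet> u = 0" using y comm_scalar_prod[OF u(1) y(1)] by simp
    have "?A *\<^sub>v (\<alpha> \<cdot>\<^sub>v u + y) = (\<alpha> * \<mu>) \<cdot>\<^sub>v u + ?A *\<^sub>v y"
      using u y mult_add_distrib_mat_vec[OF bordered_carrier, of "\<alpha> \<cdot>\<^sub>v u" n y \<gamma> \<theta>]
        mult_mat_vec[OF bordered_carrier u(1), of \<gamma> \<theta> \<alpha>] by (simp add: smult_smult_assoc)
    then show ?thesis
      using u y c[OF y(1)] 1 2
      by (simp add: scalar_prod_add_distrib[of _ n] add_scalar_prod_distrib[of _ n] power2_eq_square)
  qed
  have orth_pos: "0 < y \<bullet> (?A *\<^sub>v y)" if y: "y \<in> carrier_vec n" "y \<noteq> 0\<^sub>v n" "u \<bullet> y = 0" for y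
  proof -
    \<comment> \<open>Slide y along u into the kernel of g. The u-component can only lower the form,
      so positivity there gives positivity at y itself.\<close>
    define \<alpha> where "\<alpha> = - (g y / g u)"
    define z where "z = \<alpha> \<cdot>\<^sub>v u + y"
    have z: "z \<in> carrier_vec n" using u y by (simp add: z_def)
    have "z \<noteq> 0\<^sub>v n"
    proof
      assume "z = 0\<^sub>v n"
      then have "y \<bullet> z = 0" using y by simp
      moreover have "y \<bullet> z = y \<bullet> y"
        using u y comm_scalar_prod[OF u(1) y(1)] by (simp add: z_def scalar_prod_add_distrib[of _ n])
      ultimately show False using scalar_prod_self_pos[OF y(1,2)] by simp
    qed
    moreover have "g z = 0"
    proof -
      have "g z = \<alpha> * g u + g y"
        using u y n by (simp add: z_def g_def algebra_simps)
      then show ?thesis using gu by (simp add: \<alpha>_def)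
    qed
    ultimately have "0 < z \<bullet> (?A *\<^sub>v z)" using bordered_form_pos[OF z] by (simp add: g_def)
    then have "0 < \<alpha>\<^sup>2 * \<mu> * (u \<bullet> u) + y \<bullet> (?A *\<^sub>v y)"
      unfolding z_def expand[OF y(1,3)] .
    moreover have "\<alpha>\<^sup>2 * \<mu> * (u \<bullet> u) \<le> 0"
      using mu uu by (intro mult_nonpos_nonneg mult_nonneg_nonpos) auto
    ultimately show ?thesis by linarith
  qed
  \<comment> \<open>Chosen so that \<mu> + t |u|^2 = 1.\<close>
  define t where "t = (1 - \<mu>) / (u \<bullet> u)"
  define B where "B = ?A + t \<cdot>\<^sub>m outer u u"
  have O: "outer u u \<in> carrier_mat n n" using u by simp
  have B: "B \<in> carrier_mat n n" using O by (simp add: B_def)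
  have "pos_def B"
    unfolding pos_def_def
  proof (intro ballI impI)
    fix x :: "real vec" assume "x \<in> carrier_vec (dim_row B)" "x \<noteq> 0\<^sub>v (dim_row B)"
    then have x: "x \<in> carrier_vec n" "x \<noteq> 0\<^sub>v n" using B by auto
    define \<alpha> where "\<alpha> = (u \<bullet> x) / (u \<bullet> u)"
    define y where "y = x - \<alpha> \<cdot>\<^sub>v u"
    have y: "y \<in> carrier_vec n" using x u by (simp add: y_def)
    have uy: "u \<bullet> y = 0"
      using x u uu by (simp add: y_def scalar_prod_minus_distrib[of _ n] \<alpha>_def)
    have xe: "x = \<alpha> \<cdot>\<^sub>v u + y" using x u by (intro eq_vecI) (auto simp: y_def)
    have tu: "t \<cdot>\<^sub>m outer u u = outer (t \<cdot>\<^sub>v u) u"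
      using u by (intro eq_matI) (auto simp: outer_def)
    have "x \<bullet> (B *\<^sub>v x) = x \<bullet> (?A *\<^sub>v x) + x \<bullet> (outer (t \<cdot>\<^sub>v u) u *\<^sub>v x)"
      unfolding B_def tu using x u c[OF x(1)] mult_mat_vec_carrier[of "outer (t \<cdot>\<^sub>v u) u" n n x]
      by (simp add: add_mult_distrib_mat_vec[OF bordered_carrier] scalar_prod_add_distrib[of _ n])
    also have "x \<bullet> (outer (t \<cdot>\<^sub>v u) u *\<^sub>v x) = t * (u \<bullet> x)\<^sup>2"
      using x u by (simp add: scalar_prod_outer[of _ n] power2_eq_square)
    also have "u \<bullet> x = \<alpha> * (u \<bullet> u)" using uu by (simp add: \<alpha>_def)
    also have "x \<bullet> (?A *\<^sub>v x) = \<alpha>\<^sup>2 * \<mu> * (u \<bullet> u) + y \<bullet> (?A *\<^sub>v y)"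
      unfolding xe by (rule expand[OF y uy])
    also have "\<alpha>\<^sup>2 * \<mu> * (u \<bullet> u) + y \<bullet> (?A *\<^sub>v y) + t * (\<alpha> * (u \<bullet> u))\<^sup>2
        = \<alpha>\<^sup>2 * (u \<bullet> u) + y \<bullet> (?A *\<^sub>v y)"
      using uu by (simp add: t_def power2_eq_square field_simps)
    also have "\<dots> > 0"
    proof (cases "y = 0\<^sub>v n")
      case True
      then have "\<alpha> \<noteq> 0" using x u xe by auto
      then show ?thesis using uu True c[of "0\<^sub>v n"] by simp
    next
      case False
      then show ?thesis using orth_pos[OF y False uy] uu by (intro add_nonneg_pos) auto
    qed
    finally show "0 < x \<bullet> (B *\<^sub>v x)" .
  qed
  then have Bpos: "0 < l" if "l \<in># eigenvalues B" for l
    using pos_def_eigenvalue_pos[OF B] in_eigenvalues_iff[OF B] that by blast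
  have "eigenvalues B + {#\<mu>#} = eigenvalues ?A + {#\<mu> + t * (u \<bullet> u)#}"
    unfolding B_def by (rule eigenvalues_plus_outer[OF bordered_carrier u(1,3)])
  then have EB: "eigenvalues B = eigenvalues ?A + {#\<mu> + t * (u \<bullet> u)#} - {#\<mu>#}"
    by (metis add_diff_cancel_right')
  have muA: "\<mu> \<in># eigenvalues ?A" using mu in_eigenvalues_iff[OF bordered_carrier] by blast
  have "\<mu> \<in># eigenvalues ?A + {#0#}" using muA by simp
  \<comment> \<open>Being negative, \<mu> is neither the n gained by bordering nor the removed 0, so
    it belongs to the nontrivial spectrum of the Jacobian.\<close>
  then have muJ: "\<mu> \<in># eigenvalues (jacobian n \<gamma> \<theta>) - {#0#}"
    using mu unfolding eigenvalues_bordered by (auto simp: in_diff_count)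
  have "0 < l" if "l \<in># eigenvalues (jacobian n \<gamma> \<theta>) - {#0#} - {#\<mu>#}" for l
  proof (rule Bpos)
    have "l \<in># eigenvalues ?A - {#\<mu>#}"
      using that mset_subset_eq_count[OF eigenvalues_jacobian_minus, of l]
      unfolding in_diff_count by linarith
    then show "l \<in># eigenvalues B" using muA by (simp add: EB)
  qed
  then show ?thesis
    unfolding one_saddle_def Let_def using eigenvector_ones muJ mu by blast
qed

end

section \<open>Folds of explicit curves of solutions\<close>

text \<open>Used to parametrise each half of a fold by its height. The intermediate value theorem
  gives the image, and compactness of the domain gives continuity of the inverse.\<close>

lemma strict_mono_inverse:
  fixes f :: "real \<Rightarrow> real"
  assumes ab: "a < b" and cont: "continuous_on {a..b} f" and mono: "strict_mono_on {a..b} f"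
  obtains g where "continuous_on {f a..f b} g" "g (f a) = a"
    "\<And>s. s \<in> {f a..f b} \<Longrightarrow> g s \<in> {a..b} \<and> f (g s) = s"
proof -
  define g where "g = the_inv_into {a..b} f"
  have inj: "inj_on f {a..b}" using mono by (rule strict_mono_on_imp_inj_on)
  have gf: "g (f x) = x" if "x \<in> {a..b}" for x
    using the_inv_into_f_f[OF inj that] by (simp add: g_def)
  have fab: "f a < f b" using strict_mono_onD[OF mono, of a b] ab by simp
  have img: "f ` {a..b} = {f a..f b}"
  proof (rule antisym)
    show "f ` {a..b} \<subseteq> {f a..f b}"
      using strict_mono_on_leD[OF mono] ab by auto
    show "{f a..f b} \<subseteq> f ` {a..b}"
    proof
      fix s assume "s \<in> {f a..f b}"
      then show "s \<in> f ` {a..b}"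
        using IVT'[of f a s b] cont ab by auto
    qed
  qed
  have "continuous_on (f ` {a..b}) g"
    by (rule continuous_on_inv[OF cont]) (auto simp: gf)
  then have "continuous_on {f a..f b} g" unfolding img .
  moreover have "g (f a) = a" using gf[of a] ab by simp
  moreover have "g s \<in> {a..b} \<and> f (g s) = s" if s: "s \<in> {f a..f b}" for s
  proof -
    have "s \<in> f ` {a..b}" using s img by simp
    then obtain x where x: "x \<in> {a..b}" "s = f x" by (rule imageE)
    show ?thesis unfolding x(2) gf[OF x(1)] using x(1) by simp
  qed
  ultimately show thesis by (rule that)
qed

text \<open>A strict local minimum of \<open>f = 1 / \<sigma>\<close> is a maximum of \<open>\<sigma>\<close>: the two halves of the curve are the
  branches, and they disappear together.\<close>

locale fold_curve =
  fixes n :: nat and \<omega> \<gamma> :: "real vec" and \<Theta> :: "real \<Rightarrow> real vec"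
    and f :: "real \<Rightarrow> real" and c d :: real
  assumes d: "0 < d" and fc: "0 < f c"
    and cont_f: "continuous_on {c - d..c + d} f"
    and dec: "\<And>x y. c - d \<le> x \<Longrightarrow> x < y \<Longrightarrow> y \<le> c \<Longrightarrow> f y < f x"
    and inc: "\<And>x y. c \<le> x \<Longrightarrow> x < y \<Longrightarrow> y \<le> c + d \<Longrightarrow> f x < f y"
    and cont: "\<And>i. i < n \<Longrightarrow> continuous_on {c - d..c + d} (\<lambda>y. \<Theta> y $ i)"
    and pl: "\<And>y. y \<in> {c - d..c + d} \<Longrightarrow> phase_locked n \<omega> \<gamma> (1 / f y) (\<Theta> y)"
    and dr: "\<And>y. y \<in> {c - d..c + d} \<Longrightarrow> y \<noteq> c \<Longrightarrow> det_red n (jacobian n \<gamma> (\<Theta> y)) \<noteq> 0"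
    and distinct: "\<And>x y k. x \<in> {c - d..c + d} \<Longrightarrow> y \<in> {c - d..c + d} \<Longrightarrow> \<Theta> x - \<Theta> y = k \<cdot>\<^sub>v ones n \<Longrightarrow> x = y"
begin

text \<open>The radius puts the left end of the parameter interval at 1 / M > 0, so 1 / \<sigma>
  stays within the heights on which g is defined and equals \<open>f c\<close> only at the
  fold.\<close>

lemma branch_of_inverse:
  assumes M: "f c < M" and g: "continuous_on {f c..M} g"
    and fg: "\<And>s. s \<in> {f c..M} \<Longrightarrow> g s \<in> {c - d..c + d} \<and> f (g s) = s"
  shows "branch n \<omega> \<gamma> (1 / f c) (1 / f c - 1 / M) (\<lambda>\<sigma>. \<Theta> (g (1 / \<sigma>)))"
proof -
  have M0: "0 < M" using M fc by linarith
  have s: "0 < \<sigma>" "1 / \<sigma> \<in> {f c..M}" "\<sigma> \<noteq> 1 / f c \<Longrightarrow> 1 / \<sigma> \<noteq> f c"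
    if "\<sigma> \<in> {1 / f c - (1 / f c - 1 / M)<..1 / f c}" for \<sigma>
  proof -
    have "1 / M < \<sigma>" "\<sigma> \<le> 1 / f c" using that by auto
    moreover from this have "0 < \<sigma>" using M0 by (meson less_trans zero_less_divide_1_iff)
    ultimately show "0 < \<sigma>" "1 / \<sigma> \<in> {f c..M}" using M0 fc by (auto simp: field_simps)
    show "\<sigma> \<noteq> 1 / f c \<Longrightarrow> 1 / \<sigma> \<noteq> f c"
      by (metis inverse_eq_divide inverse_inverse_eq)
  qed
  show ?thesis
    unfolding branch_def
  proof (intro conjI ballI allI impI)
    fix \<sigma> assume "\<sigma> \<in> {1 / f c - (1 / f c - 1 / M)<..1 / f c}"
    note s = s[OF this]
    show "phase_locked n \<omega> \<gamma> \<sigma> (\<Theta> (g (1 / \<sigma>)))"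
      using pl[of "g (1 / \<sigma>)"] fg[OF s(2)] by simp
  next
    fix i assume i: "i < n"
    have "continuous_on {f c..M} (\<lambda>s. \<Theta> (g s) $ i)"
      by (rule continuous_on_compose2[OF cont[OF i] g]) (use fg in auto)
    then show "continuous_on {1 / f c - (1 / f c - 1 / M)<..1 / f c} (\<lambda>\<sigma>. \<Theta> (g (1 / \<sigma>)) $ i)"
    proof (rule continuous_on_compose2)
      show "continuous_on {1 / f c - (1 / f c - 1 / M)<..1 / f c} (\<lambda>\<sigma>. 1 / \<sigma>)"
        by (intro continuous_intros ballI) (metis s(1) less_irrefl)
      show "(\<lambda>\<sigma>. 1 / \<sigma>) ` {1 / f c - (1 / f c - 1 / M)<..1 / f c} \<subseteq> {f c..M}"
        using s(2) by blast
    qed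
  next
    fix \<sigma> assume a: "\<sigma> \<in> {1 / f c - (1 / f c - 1 / M)<..<1 / f c}"
    then have "\<sigma> \<in> {1 / f c - (1 / f c - 1 / M)<..1 / f c}" by simp
    note s = s[OF this]
    have "1 / \<sigma> \<noteq> f c" using s(3) a by simp
    then have "g (1 / \<sigma>) \<noteq> c" using fg[OF s(2)] by auto
    then show "det_red n (jacobian n \<gamma> (\<Theta> (g (1 / \<sigma>)))) \<noteq> 0"
      using dr fg[OF s(2)] by blast
  qed
qed

lemma branches_collide_at_fold:
  obtains \<theta>\<^sub>1 \<theta>\<^sub>2 \<epsilon> where "branches_collide n \<omega> \<gamma> (\<Theta> c) (1 / f c) \<epsilon> \<theta>\<^sub>1 \<theta>\<^sub>2"
    "\<forall>\<^sub>F \<sigma> in at_left (1 / f c). \<exists>y \<in> {c<..c + d}. \<theta>\<^sub>1 \<sigma> = \<Theta> y"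
    "\<forall>\<^sub>F \<sigma> in at_left (1 / f c). \<exists>y \<in> {c - d..<c}. \<theta>\<^sub>2 \<sigma> = \<Theta> y"
proof -
  \<comment> \<open>Reflection about c makes the decreasing half increasing, so the same inversion
    lemma serves both halves.\<close>
  define h where "h x = f (2 * c - x)" for x
  have "strict_mono_on {c..c + d} f" by (auto intro!: strict_mono_onI inc)
  moreover have "continuous_on {c..c + d} f"
    by (rule continuous_on_subset[OF cont_f]) (use d in auto)
  ultimately obtain g1 where g1: "continuous_on {f c..f (c + d)} g1" "g1 (f c) = c"
    "\<And>s. s \<in> {f c..f (c + d)} \<Longrightarrow> g1 s \<in> {c..c + d} \<and> f (g1 s) = s"
    using strict_mono_inverse[of c "c + d" f] d by auto
  have "strict_mono_on {c..c + d} h"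
    by (auto intro!: strict_mono_onI dec simp: h_def)
  moreover have "continuous_on {c..c + d} h"
    unfolding h_def
    by (rule continuous_on_compose2[OF cont_f]) (use d in \<open>auto intro!: continuous_intros\<close>)
  moreover have hc: "h c = f c" by (simp add: h_def)
  ultimately obtain g2 where g2: "continuous_on {f c..h (c + d)} g2" "g2 (f c) = c"
    "\<And>s. s \<in> {f c..h (c + d)} \<Longrightarrow> g2 s \<in> {c..c + d} \<and> h (g2 s) = s"
    using strict_mono_inverse[of c "c + d" h] d by auto
  \<comment> \<open>The lower of the two end heights, so that both inverses exist on a common
    interval.\<close>
  define M where "M = min (f (c + d)) (h (c + d))"
  have M: "f c < M" using inc[of c "c + d"] dec[of "c - d" c] d by (simp add: M_def h_def)
  define g2' where "g2' s = 2 * c - g2 s" for s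
  have c1: "continuous_on {f c..M} g1"
    by (rule continuous_on_subset[OF g1(1)]) (auto simp: M_def)
  have c2: "continuous_on {f c..M} g2'"
    unfolding g2'_def by (intro continuous_intros continuous_on_subset[OF g2(1)]) (auto simp: M_def)
  have f1: "g1 s \<in> {c..c + d} \<and> f (g1 s) = s" if "s \<in> {f c..M}" for s
    using g1(3) that by (auto simp: M_def)
  have f2: "g2' s \<in> {c - d..c} \<and> f (g2' s) = s" if "s \<in> {f c..M}" for s
    using g2(3)[of s] that by (auto simp: M_def g2'_def h_def)
  have b1: "branch n \<omega> \<gamma> (1 / f c) (1 / f c - 1 / M) (\<lambda>\<sigma>. \<Theta> (g1 (1 / \<sigma>)))"
  proof (rule branch_of_inverse[OF M c1])
    show "g1 s \<in> {c - d..c + d} \<and> f (g1 s) = s" if "s \<in> {f c..M}" for s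
      using f1[OF that] d by simp
  qed
  have b2: "branch n \<omega> \<gamma> (1 / f c) (1 / f c - 1 / M) (\<lambda>\<sigma>. \<Theta> (g2' (1 / \<sigma>)))"
  proof (rule branch_of_inverse[OF M c2])
    show "g2' s \<in> {c - d..c + d} \<and> f (g2' s) = s" if "s \<in> {f c..M}" for s
      using f2[OF that] d by simp
  qed
  have strict: "g1 (1 / \<sigma>) \<in> {c<..c + d} \<and> g2' (1 / \<sigma>) \<in> {c - d..<c}"
    if "\<sigma> \<in> {1 / M<..<1 / f c}" for \<sigma>
  proof -
    have M0: "0 < M" using M fc by linarith
    have "0 < \<sigma>" using that M0 by (meson greaterThanLessThan_iff less_trans zero_less_divide_1_iff)
    then have "1 / \<sigma> \<in> {f c..M}" "1 / \<sigma> \<noteq> f c" using that M0 fc by (auto simp: field_simps)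
    then show ?thesis using f1[of "1 / \<sigma>"] f2[of "1 / \<sigma>"] by (auto simp: less_le)
  qed
  have M0: "0 < M" "1 / M < 1 / f c" using M fc by (auto simp: field_simps)
  have c0: "\<Theta> c \<in> carrier_vec n" using pl[of c] d by (simp add: phase_locked_def)
  have "branches_collide n \<omega> \<gamma> (\<Theta> c) (1 / f c) (1 / f c - 1 / M)
      (\<lambda>\<sigma>. \<Theta> (g1 (1 / \<sigma>))) (\<lambda>\<sigma>. \<Theta> (g2' (1 / \<sigma>)))"
    unfolding branches_collide_def
  proof (intro conjI b1 b2 c0 ballI notI)
    show "\<Theta> (g1 (1 / (1 / f c))) = \<Theta> c" "\<Theta> (g2' (1 / (1 / f c))) = \<Theta> c"
      using g1(2) g2(2) by (simp_all add: g2'_def)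
    fix \<sigma> assume "\<sigma> \<in> {1 / f c - (1 / f c - 1 / M)<..<1 / f c}"
    then have "g1 (1 / \<sigma>) \<in> {c<..c + d} \<and> g2' (1 / \<sigma>) \<in> {c - d..<c}" by (intro strict) simp
    moreover assume "\<exists>k. \<Theta> (g1 (1 / \<sigma>)) - \<Theta> (g2' (1 / \<sigma>)) = k \<cdot>\<^sub>v ones n"
    then obtain k where "\<Theta> (g1 (1 / \<sigma>)) - \<Theta> (g2' (1 / \<sigma>)) = k \<cdot>\<^sub>v ones n" ..
    ultimately show False using distinct[of "g1 (1 / \<sigma>)" "g2' (1 / \<sigma>)" k] by auto
  qed (use M0 fc in auto)
  moreover have ev: "\<forall>\<^sub>F \<sigma> in at_left (1 / f c). \<sigma> \<in> {1 / M<..<1 / f c}"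
    using M0(2) by (rule eventually_at_left_real)
  moreover have "\<forall>\<^sub>F \<sigma> in at_left (1 / f c). \<exists>y \<in> {c<..c + d}. \<Theta> (g1 (1 / \<sigma>)) = \<Theta> y"
    using ev by eventually_elim (use strict in blast)
  moreover have "\<forall>\<^sub>F \<sigma> in at_left (1 / f c). \<exists>y \<in> {c - d..<c}. \<Theta> (g2' (1 / \<sigma>)) = \<Theta> y"
    using ev by eventually_elim (use strict in blast)
  ultimately show thesis using that by blast
qed

end

section \<open>The two explicit families\<close>

definition twisted_state :: "nat \<Rightarrow> real \<Rightarrow> real vec" where
  "twisted_state n y = vec n (\<lambda>i. real i * y)"

definition twisted_coupling :: "nat \<Rightarrow> real vec" where
  "twisted_coupling n = vec n (\<lambda>i. if i = n - 1 then 1 else real (n - 1))"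

definition dipole :: "nat \<Rightarrow> real vec" where
  "dipole n = vec n (\<lambda>i. if i = 0 then - 1 else if i = n - 1 then 1 else 0)"

lemma twisted_carrier[simp]:
  "twisted_state n y \<in> carrier_vec n" "twisted_coupling n \<in> carrier_vec n" "dipole n \<in> carrier_vec n"
  by (simp_all add: twisted_state_def twisted_coupling_def dipole_def)

lemma twisted_coupling_pos: "3 \<le> n \<Longrightarrow> \<forall>i<n. 0 < twisted_coupling n $ i"
  by (simp add: twisted_coupling_def)

definition twisted_height :: "nat \<Rightarrow> real \<Rightarrow> real" where
  "twisted_height n y = real (n - 1) * sin y + sin (real (n - 1) * y)"

lemma twisted_angle_diff:
  assumes "2 \<le> n" "i < n"
  shows "angle_diff n (twisted_state n y) i = (if i = n - 1 then - (real (n - 1) * y) else y)"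
  using assms by (auto simp: angle_diff_def twisted_state_def mod_Suc algebra_simps)

lemma twisted_weight:
  assumes "2 \<le> n" "i < n"
  shows "weight n (twisted_coupling n) (twisted_state n y) i =
    (if i = n - 1 then cos (real (n - 1) * y) else real (n - 1) * cos y)"
  using assms by (simp add: weight_def twisted_angle_diff twisted_coupling_def)

text \<open>Interior vertices lie between two edges of equal strength and equal angle difference, so
  their contributions cancel; only the two ends of the closing edge carry a net coupling.\<close>

lemma coupling_comb:
  assumes n: "3 \<le> n"
  shows "coupling n (twisted_coupling n) (twisted_state n y) = twisted_height n y \<cdot>\<^sub>v dipole n"
proof (rule eq_vecI)
  fix i assume "i < dim_vec (twisted_height n y \<cdot>\<^sub>v dipole n)"
  then have i: "i < n" by (simp add: dipole_def)
  define k where "k = (i + n - 1) mod n"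
  have k: "k < n" using i by (simp add: k_def)
  have k': "k = (if i = 0 then n - 1 else i - 1)"
    using i n by (cases i) (auto simp: k_def)
  have "coupling n (twisted_coupling n) (twisted_state n y) $ i =
      - twisted_coupling n $ i * sin (angle_diff n (twisted_state n y) i) +
        twisted_coupling n $ k * sin (angle_diff n (twisted_state n y) k)"
    using i by (simp add: coupling_def k_def)
  also have "\<dots> = twisted_height n y * dipole n $ i"
    using i k n unfolding twisted_angle_diff[OF _ i, simplified] twisted_angle_diff[OF _ k, simplified]
    by (auto simp: twisted_angle_diff k' twisted_coupling_def dipole_def twisted_height_def)
  finally show "coupling n (twisted_coupling n) (twisted_state n y) $ i = (twisted_height n y \<cdot>\<^sub>v dipole n) $ i"
    using i by (simp add: dipole_def)
qed (simp add: coupling_def dipole_def)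

lemma mean_dipole:
  assumes "2 \<le> n"
  shows "mean n (dipole n) = 0"
proof -
  obtain m where m: "n = Suc (Suc m)" using assms by (metis Suc_le_D numeral_2_eq_2 Suc_le_mono)
  have "(\<Sum>i<n. dipole n $ i) = (\<Sum>i<n. (if i = n - 1 then 1 else 0) - (if i = 0 then 1 else 0))"
    by (rule sum.cong) (auto simp: dipole_def m)
  also have "\<dots> = 0" by (simp add: sum_subtractf m)
  finally show ?thesis by (simp add: mean_def)
qed

lemma phase_locked_comb:
  assumes n: "3 \<le> n" and h: "twisted_height n y \<noteq> 0"
  shows "phase_locked n (dipole n) (twisted_coupling n) (1 / twisted_height n y) (twisted_state n y)"
proof (subst phase_locked_iff)
  show "(1 / twisted_height n y) \<cdot>\<^sub>v coupling n (twisted_coupling n) (twisted_state n y) =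
      dipole n - mean n (dipole n) \<cdot>\<^sub>v ones n"
    using n h mean_dipole[of n]
    by (intro eq_vecI) (auto simp: coupling_comb dipole_def ones_def)
qed (use n in \<open>simp_all add: dipole_def twisted_state_def\<close>)

section \<open>The fold of the twisted states for n at least 4\<close>

text \<open>
  The derivative of the height is \<open>m (cos y + cos (m y))\<close>, which changes sign at \<open>c = \<pi> / (m - 1)\<close>.
  The half-width \<open>d\<close> is small enough to keep the signs of all the weights on either side of \<open>c\<close>.
\<close>

locale twisted_fold =
  fixes n :: nat and m c d :: real
  assumes n: "4 \<le> n"
  defines "m \<equiv> real (n - 1)" and "c \<equiv> pi / (m - 1)" and "d \<equiv> c / (2 * (m + 1))"
begin

lemma m_ge: "3 \<le> m" using n by (simp add: m_def)

lemma m_eq: "real (n - Suc 0) = m" "real n - 1 = m"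
  using n by (simp_all add: m_def)

lemma c_bounds: "0 < c" "c \<le> pi / 2" "(m - 1) * c = pi"
  using m_ge by (simp_all add: c_def field_simps)

lemma d_bounds: "0 < d" "(m + 1) * d = c / 2"
  using m_ge c_bounds by (simp_all add: d_def field_simps)

text \<open>In order, these estimates serve the sign of the first sine in \<open>cos_sum\<close>,
  the nonvanishing of cos (m y) and of cos y, and the sign of the second sine.\<close>

lemma bounds:
  assumes "\<bar>e\<bar> \<le> d"
  shows "\<bar>(m + 1) * e / 2\<bar> \<le> c / 4" "\<bar>m * e\<bar> < c / 2" "\<bar>e\<bar> < c / 2" "\<bar>(m - 1) * e / 2\<bar> < pi"
proof -
  have 1: "(m + 1) * \<bar>e\<bar> \<le> c / 2"
    using mult_left_mono[OF assms, of "m + 1"] m_ge d_bounds by simp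
  moreover have "\<bar>(m + 1) * e / 2\<bar> = (m + 1) * \<bar>e\<bar> / 2" using m_ge by (simp add: abs_mult)
  ultimately show "\<bar>(m + 1) * e / 2\<bar> \<le> c / 4" by linarith
  have "d < c / 2" using m_ge c_bounds by (simp add: d_def field_simps)
  then show e: "\<bar>e\<bar> < c / 2" using assms by simp
  have 2: "m * \<bar>e\<bar> < c / 2"
  proof (cases "e = 0")
    case False
    then have "0 < \<bar>e\<bar>" by simp
    then show ?thesis using 1 by (simp add: distrib_right)
  qed (use c_bounds in simp)
  then show "\<bar>m * e\<bar> < c / 2" using m_ge by (simp add: abs_mult)
  have "\<bar>(m - 1) * e / 2\<bar> = (m - 1) * \<bar>e\<bar> / 2" using m_ge by (simp add: abs_mult)
  also have "\<dots> \<le> m * \<bar>e\<bar>" using m_ge by (simp add: field_simps)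
  finally show "\<bar>(m - 1) * e / 2\<bar> < pi" using 2 c_bounds by linarith
qed

text \<open>Since (m - 1) c = pi, the half sum and half difference of the two arguments are both
  shifted by pi / 2, so the product of cosines becomes a product of sines. The first is positive
  near c, and the second has the sign of e.\<close>

lemma cos_sum:
  "cos (c + e) + cos (m * (c + e)) = 2 * sin (c + (m + 1) * e / 2) * sin ((m - 1) * e / 2)"
proof -
  have 1: "(m * (c + e) + (c + e)) / 2 = (c + (m + 1) * e / 2) + pi / 2"
    using c_bounds(3) by (simp add: field_simps)
  have 2: "(m * (c + e) - (c + e)) / 2 = (m - 1) * e / 2 + pi / 2"
    using c_bounds(3) by (simp add: field_simps)
  have "cos (m * (c + e)) + cos (c + e) =
      2 * cos ((m * (c + e) + (c + e)) / 2) * cos ((m * (c + e) - (c + e)) / 2)"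
    by (rule cos_plus_cos)
  then show ?thesis unfolding 1 2 by (simp add: cos_add)
qed

lemma sin_pos: "\<bar>e\<bar> \<le> d \<Longrightarrow> 0 < sin (c + (m + 1) * e / 2)"
  using bounds(1)[of e] c_bounds by (intro sin_gt_zero) linarith+

lemma cos_sum_pos:
  assumes "0 < e" "e \<le> d"
  shows "0 < cos (c + e) + cos (m * (c + e))"
proof -
  have "0 < sin ((m - 1) * e / 2)"
    using assms bounds(4)[of e] m_ge by (intro sin_gt_zero) auto
  then show ?thesis
    unfolding cos_sum using sin_pos[of e] assms by simp
qed

lemma cos_sum_neg:
  assumes "e < 0" "- d \<le> e"
  shows "cos (c + e) + cos (m * (c + e)) < 0"
proof -
  have "0 < sin (- ((m - 1) * e / 2))"
    using assms bounds(4)[of e] m_ge by (intro sin_gt_zero) (auto simp: mult_pos_neg)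
  then show ?thesis
    unfolding cos_sum using sin_pos[of e] assms by (intro mult_pos_neg) auto
qed

text \<open>For n = 4 the centre c is pi / 2 itself, and t \<noteq> 0 moves away from it. For n
  \<ge> 5 one has c \<le> pi / 3, so c + t < 3 c / 2 \<le> pi / 2.\<close>

lemma cos_nonzero:
  assumes t: "\<bar>t\<bar> < c / 2" "t \<noteq> 0"
  shows "cos (c + t) \<noteq> 0"
proof
  assume "cos (c + t) = 0"
  then have eq: "cos (c + t) = cos (pi / 2)" by simp
  have b: "0 \<le> c + t" "c + t \<le> pi" "0 \<le> pi / 2" "pi / 2 \<le> pi" using t c_bounds by linarith+
  from cos_inj_pi[OF b eq] have eq: "c + t = pi / 2" .
  show False
  proof (cases "n = 4")
    case True
    then have "c = pi / 2" by (simp add: c_def m_def)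
    then show False using eq t by simp
  next
    case False
    then have "5 \<le> n" using n by simp
    then have "4 \<le> m" by (simp add: m_def)
    then have "c \<le> pi / 3" by (simp add: c_def field_simps)
    then show False using eq t by linarith
  qed
qed

lemma cos_mult: "cos (m * (c + e)) = - cos (c + m * e)"
proof -
  have "m * (c + e) = (c + m * e) + pi" using c_bounds(3) by (simp add: field_simps)
  then show ?thesis by simp
qed

lemma height_deriv:
  "(twisted_height n has_real_derivative m * (cos y + cos (m * y))) (at y)"
  unfolding twisted_height_def m_def
  by (auto intro!: derivative_eq_intros simp: algebra_simps)

lemma height_cont: "continuous_on S (twisted_height n)"
  unfolding twisted_height_def by (intro continuous_intros)

lemma height_center: "0 < twisted_height n c"
proof -
  have "m * c = c + pi" using c_bounds(3) by (simp add: field_simps)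
  then have "twisted_height n c = (m - 1) * sin c"
    by (simp add: twisted_height_def m_eq algebra_simps)
  moreover have "0 < sin c" using c_bounds by (intro sin_gt_zero) linarith+
  ultimately show ?thesis using m_ge by simp
qed

lemma height_inc:
  assumes "c \<le> x" "x < y" "y \<le> c + d"
  shows "twisted_height n x < twisted_height n y"
proof (rule DERIV_pos_imp_increasing_open[OF assms(2)])
  fix z assume "x < z" "z < y"
  then have "0 < m * (cos z + cos (m * z))"
    using cos_sum_pos[of "z - c"] assms m_ge by (intro mult_pos_pos) auto
  then show "\<exists>D. (twisted_height n has_real_derivative D) (at z) \<and> 0 < D" using height_deriv by blast
qed (rule height_cont)

lemma height_dec:
  assumes "c - d \<le> x" "x < y" "y \<le> c"
  shows "twisted_height n y < twisted_height n x"
proof (rule DERIV_neg_imp_decreasing_open[OF assms(2)])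
  fix z assume "x < z" "z < y"
  then have "m * (cos z + cos (m * z)) < 0"
    using cos_sum_neg[of "z - c"] assms m_ge by (intro mult_pos_neg) auto
  then show "\<exists>D. (twisted_height n has_real_derivative D) (at z) \<and> D < 0" using height_deriv by blast
qed (rule height_cont)

lemma height_pos:
  assumes "y \<in> {c - d..c + d}"
  shows "0 < twisted_height n y"
proof -
  have "twisted_height n c \<le> twisted_height n y"
    using assms height_inc[of c y] height_dec[of y c] by (cases y c rule: linorder_cases) auto
  then show ?thesis using height_center by simp
qed

lemma cos_sum_nonzero:
  assumes "y \<in> {c - d..c + d}" "y \<noteq> c"
  shows "cos y \<noteq> 0" "cos (m * y) \<noteq> 0" "cos y + cos (m * y) \<noteq> 0"
proof -
  define e where "e = y - c"
  have y: "y = c + e" and e: "\<bar>e\<bar> \<le> d" "e \<noteq> 0" using assms by (auto simp: e_def)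
  show "cos y \<noteq> 0" unfolding y using bounds(3)[OF e(1)] e by (intro cos_nonzero)
  show "cos (m * y) \<noteq> 0"
    unfolding y cos_mult using cos_nonzero[of "m * e"] bounds(2)[OF e(1)] e m_ge by simp
  show "cos y + cos (m * y) \<noteq> 0"
    unfolding y using cos_sum_pos[of e] cos_sum_neg[of e] e by (cases "0 < e") auto
qed

sublocale fold_curve n "dipole n" "twisted_coupling n" "twisted_state n" "twisted_height n" c d
proof
  fix i assume "i < n"
  then show "continuous_on {c - d..c + d} (\<lambda>y. twisted_state n y $ i)"
    by (simp add: twisted_state_def continuous_intros)
next
  fix y assume y: "y \<in> {c - d..c + d}"
  show "phase_locked n (dipole n) (twisted_coupling n) (1 / twisted_height n y) (twisted_state n y)"
    using height_pos[OF y] n by (intro phase_locked_comb) auto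
  assume "y \<noteq> c"
  note nz = cos_sum_nonzero[OF y this]
  let ?w = "weight n (twisted_coupling n) (twisted_state n y)"
  have mn: "n = Suc (n - 1)" using n by simp
  have "(\<Sum>i<n. 1 / ?w i) = (\<Sum>i<n - 1. 1 / ?w i) + 1 / ?w (n - 1)"
    by (subst mn) simp
  also have "(\<Sum>i<n - 1. 1 / ?w i) = (\<Sum>i<n - 1. 1 / (m * cos y))"
    using n by (intro sum.cong) (auto simp: twisted_weight m_def)
  also have "\<dots> = 1 / cos y" using m_ge by (simp add: m_def)
  also have "1 / ?w (n - 1) = 1 / cos (m * y)" using n by (simp add: twisted_weight m_def)
  \<comment> \<open>The numerator is the derivative of the height divided by m, so on this interval
    degeneracy can occur only at the fold.\<close>
  finally have "(\<Sum>i<n. 1 / ?w i) = (cos y + cos (m * y)) / (cos y * cos (m * y))"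
    using nz by (simp add: field_simps)
  then have s: "(\<Sum>i<n. 1 / ?w i) \<noteq> 0" using nz by simp
  have "?w i \<noteq> 0" if "i < n" for i
    using that n m_ge nz by (simp add: twisted_weight m_def)
  then show "det_red n (jacobian n (twisted_coupling n) (twisted_state n y)) \<noteq> 0"
    using n s by (intro det_red_jacobian_nonzero) (auto simp: twisted_state_def)
next
  fix x y k assume eq: "twisted_state n x - twisted_state n y = k \<cdot>\<^sub>v ones n"
  show "x = y"
    using arg_cong[OF eq, of "\<lambda>v. v $ 0"] arg_cong[OF eq, of "\<lambda>v. v $ 1"] n
    by (simp add: twisted_state_def ones_def)
qed (use d_bounds height_center height_cont height_inc height_dec in simp_all)

text \<open>Here n \<ge> 5 enters: then 3 c / 2 \<le> pi / 2 keeps the chain weights positive on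
  both sides of the fold, whereas for n = 4 they change sign at c = pi / 2.\<close>

lemma one_odd_edge_comb:
  assumes n5: "5 \<le> n" and y: "y \<in> {c - d..c + d}"
  shows "one_odd_edge n (twisted_coupling n) (twisted_state n y) (m * cos y) (cos (m * y))"
proof
  have "4 \<le> m" using n5 by (simp add: m_def)
  then have "c \<le> pi / 3" by (simp add: c_def field_simps)
  moreover have "\<bar>y - c\<bar> < c / 2" using bounds(3)[of "y - c"] y by (auto simp: abs_le_iff)
  ultimately have "0 < cos y" using c_bounds by (intro cos_gt_zero_pi) linarith+
  then show "0 < m * cos y" using m_ge by simp
qed (use n in \<open>auto simp: twisted_weight m_eq\<close>)

lemma twisted_stable:
  assumes "5 \<le> n" "y \<in> {c<..c + d}"
  shows "linearly_stable n (twisted_coupling n) (twisted_state n y)"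
proof -
  have "y \<in> {c - d..c + d}" using assms d_bounds by auto
  interpret one_odd_edge n "twisted_coupling n" "twisted_state n y" "m * cos y" "cos (m * y)"
    by (rule one_odd_edge_comb) fact+
  have "0 < m * (cos y + cos (m * y))"
    using cos_sum_pos[of "y - c"] assms m_ge by (intro mult_pos_pos) auto
  then show ?thesis by (intro linearly_stable) (simp add: m_eq distrib_left)
qed

lemma twisted_saddle:
  assumes "5 \<le> n" "y \<in> {c - d..<c}"
  shows "one_saddle n (twisted_coupling n) (twisted_state n y)"
proof -
  have "y \<in> {c - d..c + d}" using assms d_bounds by auto
  interpret one_odd_edge n "twisted_coupling n" "twisted_state n y" "m * cos y" "cos (m * y)"
    by (rule one_odd_edge_comb) fact+
  have "m * (cos y + cos (m * y)) < 0"
    using cos_sum_neg[of "y - c"] assms m_ge by (intro mult_pos_neg) auto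
  then show ?thesis by (intro one_saddle) (simp add: m_eq distrib_left)
qed

end

section \<open>The ring of three oscillators\<close>

text \<open>
  For three oscillators \<open>\<pi> / (m - 1) = \<pi>\<close>, where the twisted height is 0, so another curve
  is needed. For angle differences \<open>p + q\<close>, \<open>p - q\<close>, \<open>- 2 * p\<close> and coupling strengths
  1, 1, 2/5, the coupling is proportional to (-1, 2, -1) if and only if \<open>sin p = 0\<close> or
  \<open>cos q = - (4 / 5) * cos p\<close>; the second family is the one used here.
\<close>

definition tri_angle :: "real \<Rightarrow> real" where
  "tri_angle p = arccos (- (4 / 5) * cos p)"

definition tri_state :: "real \<Rightarrow> real vec" where
  "tri_state p = vec 3 (\<lambda>i. if i = 0 then 0 else if i = 1 then p + tri_angle p else 2 * p)"

definition tri_coupling :: "real vec" where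
  "tri_coupling = vec 3 (\<lambda>i. if i = 2 then 2 / 5 else 1)"

definition tri_freq :: "real vec" where
  "tri_freq = vec 3 (\<lambda>i. if i = 1 then 2 else - 1)"

definition tri_height :: "real \<Rightarrow> real" where
  "tri_height p = cos p * sin (tri_angle p)"

lemma tri_carrier[simp]:
  "tri_state p \<in> carrier_vec 3" "tri_coupling \<in> carrier_vec 3" "tri_freq \<in> carrier_vec 3"
  by (simp_all add: tri_state_def tri_coupling_def tri_freq_def)

lemma tri_angle_bounds: "- 1 \<le> - (4 / 5) * cos p" "- (4 / 5) * cos p \<le> (1 :: real)"
  using cos_le_one[of p] cos_ge_minus_one[of p] by linarith+

lemma cos_tri_angle: "cos (tri_angle p) = - (4 / 5) * cos p"
  unfolding tri_angle_def using tri_angle_bounds by (rule cos_arccos)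

lemma less_3_cases: "i < 3 \<longleftrightarrow> i = 0 \<or> i = 1 \<or> i = (2::nat)"
  by auto

lemma tri_angle_diff:
  "angle_diff 3 (tri_state p) 0 = p + tri_angle p"
  "angle_diff 3 (tri_state p) (Suc 0) = p - tri_angle p"
  "angle_diff 3 (tri_state p) (Suc (Suc 0)) = - (2 * p)" "angle_diff 3 (tri_state p) 2 = - (2 * p)"
  by (simp_all add: angle_diff_def tri_state_def)

text \<open>The relation between cos q and cos p cancels the terms in sin p at vertices 0 and 2;
  what remains is a multiple of cos p sin q.\<close>

lemma coupling_tri: "coupling 3 tri_coupling (tri_state p) = tri_height p \<cdot>\<^sub>v tri_freq"
proof (rule eq_vecI)
  fix i assume "i < dim_vec (tri_height p \<cdot>\<^sub>v tri_freq)"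
  then have "i = 0 \<or> i = 1 \<or> i = 2" by (auto simp: tri_freq_def)
  then show "coupling 3 tri_coupling (tri_state p) $ i = (tri_height p \<cdot>\<^sub>v tri_freq) $ i"
    by (elim disjE) (simp_all add: coupling_def tri_angle_diff tri_coupling_def tri_freq_def
      tri_height_def sin_add sin_diff sin_double cos_tri_angle)
qed (simp add: coupling_def tri_freq_def)

lemma phase_locked_tri:
  assumes "tri_height p \<noteq> 0"
  shows "phase_locked 3 tri_freq tri_coupling (1 / tri_height p) (tri_state p)"
proof -
  have 1: "mean 3 tri_freq = 0" by (simp add: mean_def tri_freq_def numeral_3_eq_3)
  have "(1 / tri_height p) \<cdot>\<^sub>v coupling 3 tri_coupling (tri_state p) = tri_freq - mean 3 tri_freq \<cdot>\<^sub>v ones 3"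
    unfolding 1 coupling_tri using assms by (intro eq_vecI) (auto simp: tri_freq_def ones_def)
  then show ?thesis by (subst phase_locked_iff) simp_all
qed

lemma cos_quarter:
  fixes p :: real
  assumes "\<bar>p\<bar> \<le> 1 / 4"
  shows "0 < cos p" "15 / 16 \<le> (cos p)\<^sup>2"
proof -
  have "\<bar>sin p\<bar> \<le> 1 / 4" using abs_sin_x_le_abs_x[of p] assms by linarith
  then have "(sin p)\<^sup>2 \<le> (1 / 4)\<^sup>2" by (metis abs_ge_zero power2_abs power_mono)
  then have "(sin p)\<^sup>2 \<le> 1 / 16" by (simp add: power2_eq_square)
  then show "15 / 16 \<le> (cos p)\<^sup>2" by (simp add: cos_squared_eq)
  show "0 < cos p" using assms pi_gt3 by (intro cos_gt_zero_pi) linarith+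
qed

lemma tri_height_sq: "(tri_height p)\<^sup>2 = (cos p)\<^sup>2 * (1 - 16 / 25 * (cos p)\<^sup>2)"
  by (simp add: tri_height_def power_mult_distrib sin_squared_eq cos_tri_angle power_divide)

lemma tri_height_pos:
  assumes "\<bar>p\<bar> \<le> 1 / 4"
  shows "0 < tri_height p"
proof -
  have "0 < sin (tri_angle p)"
  proof (rule sin_gt_zero)
    have "- (4 / 5) * cos p \<noteq> 1" "- (4 / 5) * cos p \<noteq> - 1" using cos_le_one[of p] cos_ge_minus_one[of p] by linarith+
    then show "0 < tri_angle p" "tri_angle p < pi"
      using arccos_lt_bounded[of "- (4 / 5) * cos p"] tri_angle_bounds[of p] by (auto simp: tri_angle_def)
  qed
  then show ?thesis using cos_quarter[OF assms] by (simp add: tri_height_def)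
qed

text \<open>The squared height is X (1 - 16/25 X) with X = (cos p)^2, which decreases in X beyond
  25/32. For |p| \<le> 1/4 one has X \<ge> 15/16, so the height grows with |p| and p = 0 is a strict
  minimum.\<close>

lemma tri_height_less:
  assumes "\<bar>x\<bar> < \<bar>y\<bar>" "\<bar>y\<bar> \<le> 1 / 4"
  shows "tri_height x < tri_height y"
proof -
  have "cos \<bar>y\<bar> < cos \<bar>x\<bar>"
    using assms pi_gt3 by (intro cos_monotone_0_pi) linarith+
  then have c: "cos y < cos x" by simp
  define X Z where "X = (cos x)\<^sup>2" and "Z = (cos y)\<^sup>2"
  have "Z < X" unfolding X_def Z_def
    using c cos_quarter[OF assms(2)] by (intro power_strict_mono) auto
  moreover have "15 / 16 \<le> Z" unfolding Z_def by (rule cos_quarter(2)[OF assms(2)])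
  ultimately have "0 < (X - Z) * (16 / 25 * (X + Z) - 1)"
    by (intro mult_pos_pos) auto
  then have "(tri_height x)\<^sup>2 < (tri_height y)\<^sup>2"
    unfolding tri_height_sq X_def[symmetric] Z_def[symmetric] by (simp add: field_simps)
  then show ?thesis
    using tri_height_pos[OF assms(2)] by (meson less_imp_le power2_less_imp_less)
qed

lemma tri_height_cont: "continuous_on S tri_height"
  unfolding tri_height_def tri_angle_def
  by (intro continuous_intros ballI) (use tri_angle_bounds in auto)

lemma det_red_tri:
  assumes p: "\<bar>p\<bar> \<le> 1 / 4" "p \<noteq> 0"
  shows "det_red 3 (jacobian 3 tri_coupling (tri_state p)) \<noteq> 0"
proof -
  define X where "X = (cos p)\<^sup>2"
  have X: "15 / 16 \<le> X" unfolding X_def by (rule cos_quarter(2)[OF p(1)])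
  have "cos p < 1"
    using cos_monotone_0_pi[of 0 "\<bar>p\<bar>"] p pi_gt3 by simp
  then have X1: "X < 1"
    using cos_quarter(1)[OF p(1)] unfolding X_def by (simp add: power_less_one_iff)
  let ?w = "weight 3 tri_coupling (tri_state p)"
  have w2: "?w 2 = 2 / 5 * (2 * X - 1)"
    by (simp add: weight_def tri_angle_diff tri_coupling_def cos_double_cos X_def)
  have s: "(sin (tri_angle p))\<^sup>2 = 1 - 16 / 25 * X" "(sin p)\<^sup>2 = 1 - X"
    "(cos (tri_angle p))\<^sup>2 = 16 / 25 * X"
    by (simp_all add: sin_squared_eq cos_tri_angle power_divide power_mult_distrib X_def)
  have w01: "?w 0 * ?w 1 = 41 / 25 * X - 1"
  proof -
    have "?w 0 * ?w 1 = (cos p)\<^sup>2 * (cos (tri_angle p))\<^sup>2 - (sin p)\<^sup>2 * (sin (tri_angle p))\<^sup>2"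
      by (simp add: weight_def tri_angle_diff tri_coupling_def cos_add cos_diff power2_eq_square algebra_simps)
    then show ?thesis
      unfolding s X_def[symmetric] by (simp add: field_simps)
  qed
  have w0_1: "?w 0 + ?w 1 = - (8 / 5) * X"
    by (simp add: weight_def tri_angle_diff tri_coupling_def cos_add cos_diff cos_tri_angle X_def power2_eq_square)
  \<comment> \<open>This second elementary symmetric function of the weights is the numerator of the
    sum of reciprocals. Its factor 1 - X vanishes only at p = 0 in the interval considered.\<close>
  have "?w 0 * ?w 1 + (?w 0 + ?w 1) * ?w 2 = (1 - X) * (32 / 25 * X - 1)"
    unfolding w01 w0_1 w2 by (simp add: field_simps)
  also have "\<dots> > 0" using X X1 by (intro mult_pos_pos) auto
  finally have pos: "0 < ?w 0 * ?w 1 + (?w 0 + ?w 1) * ?w 2" .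
  have nz: "?w 0 \<noteq> 0" "?w 1 \<noteq> 0" "?w 2 \<noteq> 0" using w01 w2 X by auto
  then have "(\<Sum>i<3. 1 / ?w i) = (?w 0 * ?w 1 + (?w 0 + ?w 1) * ?w 2) / (?w 0 * ?w 1 * ?w 2)"
    by (simp add: numeral_3_eq_3 numeral_2_eq_2 field_simps)
  then have "(\<Sum>i<3. 1 / ?w i) \<noteq> 0" using pos nz by simp
  then show ?thesis
    using nz by (intro det_red_jacobian_nonzero) (auto simp: tri_state_def less_3_cases)
qed

interpretation tri: fold_curve 3 tri_freq tri_coupling tri_state tri_height 0 "1 / 4"
proof
  fix i :: nat assume "i < 3"
  then show "continuous_on {0 - 1 / 4..0 + 1 / 4} (\<lambda>p. tri_state p $ i)"
    unfolding less_3_cases using tri_angle_bounds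
    by (auto simp: tri_state_def tri_angle_def intro!: continuous_intros)
next
  fix p :: real assume "p \<in> {0 - 1 / 4..0 + 1 / 4}"
  then have p: "\<bar>p\<bar> \<le> 1 / 4" by auto
  show "phase_locked 3 tri_freq tri_coupling (1 / tri_height p) (tri_state p)"
    using tri_height_pos[OF p] by (intro phase_locked_tri) simp
  show "det_red 3 (jacobian 3 tri_coupling (tri_state p)) \<noteq> 0" if "p \<noteq> 0"
    using det_red_tri[OF p that] .
next
  fix x y k assume eq: "tri_state x - tri_state y = k \<cdot>\<^sub>v ones 3"
  show "x = y"
    using arg_cong[OF eq, of "\<lambda>v. v $ 0"] arg_cong[OF eq, of "\<lambda>v. v $ 2"]
    by (simp add: tri_state_def ones_def)
next
  fix x y :: real
  show "tri_height y < tri_height x" if "0 - 1 / 4 \<le> x" "x < y" "y \<le> 0"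
    using that by (intro tri_height_less) auto
  show "tri_height x < tri_height y" if "0 \<le> x" "x < y" "y \<le> 0 + 1 / 4"
    using that by (intro tri_height_less) auto
qed (use tri_height_pos[of 0] tri_height_cont in simp_all)

theorem theorem7:
  shows "(\<forall>n\<ge>3. \<exists>\<omega> \<in> carrier_vec n. \<exists>\<gamma> \<in> carrier_vec n. (\<forall>i<n. 0 < \<gamma> $ i) \<and>
      (\<exists>\<theta>\<^sub>0 \<sigma>\<^sub>0 \<epsilon> \<theta>\<^sub>1 \<theta>\<^sub>2. branches_collide n \<omega> \<gamma> \<theta>\<^sub>0 \<sigma>\<^sub>0 \<epsilon> \<theta>\<^sub>1 \<theta>\<^sub>2)) \<and>
    (\<forall>n\<ge>5. \<exists>\<omega> \<in> carrier_vec n. \<exists>\<gamma> \<in> carrier_vec n. (\<forall>i<n. 0 < \<gamma> $ i) \<and>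
      (\<exists>\<theta>\<^sub>0 \<sigma>\<^sub>0 \<epsilon> \<theta>\<^sub>1 \<theta>\<^sub>2. branches_collide n \<omega> \<gamma> \<theta>\<^sub>0 \<sigma>\<^sub>0 \<epsilon> \<theta>\<^sub>1 \<theta>\<^sub>2 \<and>
        (\<forall>\<^sub>F \<sigma> in at_left \<sigma>\<^sub>0. linearly_stable n \<gamma> (\<theta>\<^sub>1 \<sigma>)) \<and>
        (\<forall>\<^sub>F \<sigma> in at_left \<sigma>\<^sub>0. one_saddle n \<gamma> (\<theta>\<^sub>2 \<sigma>))))"
proof (intro conjI allI impI)
  fix n :: nat assume n3: "3 \<le> n"
  show "\<exists>\<omega> \<in> carrier_vec n. \<exists>\<gamma> \<in> carrier_vec n. (\<forall>i<n. 0 < \<gamma> $ i) \<and>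
      (\<exists>\<theta>\<^sub>0 \<sigma>\<^sub>0 \<epsilon> \<theta>\<^sub>1 \<theta>\<^sub>2. branches_collide n \<omega> \<gamma> \<theta>\<^sub>0 \<sigma>\<^sub>0 \<epsilon> \<theta>\<^sub>1 \<theta>\<^sub>2)"
  proof (cases "n = 3")
    case True
    obtain \<theta>\<^sub>1 \<theta>\<^sub>2 \<epsilon> where "branches_collide 3 tri_freq tri_coupling (tri_state 0) (1 / tri_height 0) \<epsilon> \<theta>\<^sub>1 \<theta>\<^sub>2"
      by (rule tri.branches_collide_at_fold)
    moreover have "\<forall>i<3. 0 < tri_coupling $ i" by (simp add: tri_coupling_def)
    ultimately show ?thesis unfolding True using tri_carrier by blast
  next
    case False
    then interpret twisted_fold n "real (n - 1)" "pi / (real (n - 1) - 1)"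
      "pi / (real (n - 1) - 1) / (2 * (real (n - 1) + 1))"
      using n3 by unfold_locales auto
    obtain \<theta>\<^sub>1 \<theta>\<^sub>2 \<epsilon> where "branches_collide n (dipole n) (twisted_coupling n)
        (twisted_state n (pi / (real (n - 1) - 1))) (1 / twisted_height n (pi / (real (n - 1) - 1))) \<epsilon> \<theta>\<^sub>1 \<theta>\<^sub>2"
      by (rule branches_collide_at_fold)
    moreover have "\<forall>i<n. 0 < twisted_coupling n $ i" using n3 by (rule twisted_coupling_pos)
    ultimately show ?thesis using twisted_carrier by blast
  qed
next
  fix n :: nat assume n5: "5 \<le> n"
  define c where "c = pi / (real (n - 1) - 1)"
  define d where "d = c / (2 * (real (n - 1) + 1))"
  interpret twisted_fold n "real (n - 1)" c d
    unfolding c_def d_def using n5 by unfold_locales auto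
  obtain \<theta>\<^sub>1 \<theta>\<^sub>2 \<epsilon> where b: "branches_collide n (dipole n) (twisted_coupling n)
        (twisted_state n c) (1 / twisted_height n c) \<epsilon> \<theta>\<^sub>1 \<theta>\<^sub>2"
    and e1: "\<forall>\<^sub>F \<sigma> in at_left (1 / twisted_height n c). \<exists>y \<in> {c<..c + d}. \<theta>\<^sub>1 \<sigma> = twisted_state n y"
    and e2: "\<forall>\<^sub>F \<sigma> in at_left (1 / twisted_height n c). \<exists>y \<in> {c - d..<c}. \<theta>\<^sub>2 \<sigma> = twisted_state n y"
    by (rule branches_collide_at_fold)
  \<comment> \<open>The stable states come from the half above c, where the height increases, and
    the 1-saddles from the half below.\<close>
  have "\<forall>\<^sub>F \<sigma> in at_left (1 / twisted_height n c). linearly_stable n (twisted_coupling n) (\<theta>\<^sub>1 \<sigma>)"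
    using e1 by eventually_elim (use twisted_stable[OF n5] in auto)
  moreover have "\<forall>\<^sub>F \<sigma> in at_left (1 / twisted_height n c). one_saddle n (twisted_coupling n) (\<theta>\<^sub>2 \<sigma>)"
    using e2 by eventually_elim (use twisted_saddle[OF n5] in auto)
  moreover have "\<forall>i<n. 0 < twisted_coupling n $ i" using n5 by (intro twisted_coupling_pos) simp
  ultimately show "\<exists>\<omega> \<in> carrier_vec n. \<exists>\<gamma> \<in> carrier_vec n. (\<forall>i<n. 0 < \<gamma> $ i) \<and>
      (\<exists>\<theta>\<^sub>0 \<sigma>\<^sub>0 \<epsilon> \<theta>\<^sub>1 \<theta>\<^sub>2. branches_collide n \<omega> \<gamma> \<theta>\<^sub>0 \<sigma>\<^sub>0 \<epsilon> \<theta>\<^sub>1 \<theta>\<^sub>2 \<and>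
        (\<forall>\<^sub>F \<sigma> in at_left \<sigma>\<^sub>0. linearly_stable n \<gamma> (\<theta>\<^sub>1 \<sigma>)) \<and>
        (\<forall>\<^sub>F \<sigma> in at_left \<sigma>\<^sub>0. one_saddle n \<gamma> (\<theta>\<^sub>2 \<sigma>)))"
    using b twisted_carrier by blast
qed

end
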